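(* Let $N_t, N_m, N_e$ be positive integers with $N_e < N_t$, put $n = N_t - N_e$, $m = \min(n, N_m)$ and $k = \max(n, N_m)$. Let $\mathbf{H}$ be an $N_m \times n$ random matrix with i.i.d. circularly symmetric complex Gaussian entries of zero mean and unit variance. Let $\eta > 0$, $g > 0$, $r_s > 0$, and set $R_s = r_s \ln(1+g\eta)$. Define $$P_{out}^{ZF} = \Pr\Big[\ln\det\Big(I_{N_m} + \tfrac{\eta}{n}\mathbf{H}\mathbf{H}^{\dagger}\Big) < R_s\Big].$$ Then for all positive coefficients $a_1,\dots,a_m$ satisfying $a_m \le \dots \le a_1$ and $\sum_{l=1}^m a_l = r_s$, $$P_{out}^{ZF} \ge \prod_{l=1}^m \Gamma_{inc}\big(\xi(a_l), k+m-2l+1\big),$$ where $\xi(x) = \frac{n}{\eta}\big((1+g\eta)^x - 1\big)$.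
   Context: $\Gamma_{inc}(x,a) = \frac{1}{(a-1)!}\int_0^x t^{a-1}e^{-t}\,dt$ for $x \ge 0$ and positive integer $a$. $\mathbf{H}^\dagger$ is the conjugate transpose. $P_{out}^{ZF}$ is the outage probability of the zero-forcing transmit scheme for the MIMO wiretap channel with SNR $\eta$, array gain $g$ and secrecy multiplexing gain $r_s$. *)

theory Defs
  imports "HOL-Probability.Probability" "Jordan_Normal_Form.Determinant"
begin

definition Gamma_inc :: "real \<Rightarrow> nat \<Rightarrow> real" where
  "Gamma_inc x a = (1 / fact (a - 1)) * (LBINT t=0..x. t ^ (a - 1) * exp (- t))"

definition CN01 :: "complex measure" where
  "CN01 = density lborel (\<lambda>z. ennreal (exp (- (cmod z)\<^sup>2) / pi))"

definition gauss_matrix_measure :: "nat \<Rightarrow> nat \<Rightarrow> (nat \<times> nat \<Rightarrow> complex) measure" where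
  "gauss_matrix_measure r c = PiM ({..<r} \<times> {..<c}) (\<lambda>_. CN01)"

definition to_mat :: "nat \<Rightarrow> nat \<Rightarrow> (nat \<times> nat \<Rightarrow> complex) \<Rightarrow> complex mat" where
  "to_mat r c H = mat r c (\<lambda>(i,j). H (i,j))"

definition conj_transpose :: "complex mat \<Rightarrow> complex mat" where
  "conj_transpose A = transpose_mat (map_mat cnj A)"

text \<open>Outage probability of the ZF scheme:
  P[ ln det(I_Nm + (eta/n) H H^dagger) < R_s ], R_s = r_s ln(1+g eta), H is Nm x n.
  The determinant is real and positive; we take its real part.\<close>
definition P_out_ZF :: "nat \<Rightarrow> nat \<Rightarrow> real \<Rightarrow> real \<Rightarrow> real \<Rightarrow> real" where
  "P_out_ZF Nm n \<eta> g rs =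
     measure (gauss_matrix_measure Nm n)
       {H \<in> space (gauss_matrix_measure Nm n).
          ln (Re (det (1\<^sub>m Nm + smult_mat (complex_of_real (\<eta> / real n))
                 (to_mat Nm n H * conj_transpose (to_mat Nm n H)))))
          < rs * ln (1 + g * \<eta>)}"

definition xi_fun :: "nat \<Rightarrow> real \<Rightarrow> real \<Rightarrow> real \<Rightarrow> real" where
  "xi_fun n \<eta> g x = (real n / \<eta>) * ((1 + g * \<eta>) powr x - 1)"

end

theory Submission
  imports Defs
begin

text \<open>
  Write \<open>D r c\<close> for \<open>det (I + \<rho> H H\<^sup>\<dagger>)\<close> with \<open>H\<close> an \<open>r \<times> c\<close> Gaussian matrix and \<open>\<rho> = \<eta> / n\<close>.
  Condition on the last column of \<open>H\<close> and rotate the rows so that this column becomes a multiple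
  of the last unit vector; the remaining columns keep their law, by unitary invariance. Fischer's
  inequality for the partition into the last row and the others then bounds \<open>D r c\<close> by
  \<open>(1 + \<rho> Z) * D (r - 1) (c - 1)\<close>, where \<open>Z\<close> is the sum of \<open>r + c - 1\<close> independent
  unit exponentials, independent of the second factor. Iterating, \<open>D\<close> is dominated by a product of
  independent factors \<open>1 + \<rho> Z\<^sub>l\<close> with \<open>Z\<^sub>l\<close> of Gamma law with shape \<open>k + m - 2 l + 1\<close>, and the event that
  \<open>Z\<^sub>l < \<xi> (a\<^sub>l)\<close> for all \<open>l\<close> implies outage, since the \<open>a\<^sub>l\<close> sum to \<open>r\<^sub>s\<close>.
\<close>

section \<open>Gram determinants\<close>

text \<open>This is \<open>I + \<rho> H H^dagger\<close>, given entrywise on an index function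
  instead of a matrix. The leading principal block of the matrix with \<open>Suc r\<close> rows is
  then literally the one with \<open>r\<close> rows, and dropping last rows or columns of
  \<open>H\<close> only lowers \<open>r\<close> or \<open>c\<close>.\<close>

definition gram :: "real \<Rightarrow> nat \<Rightarrow> nat \<Rightarrow> (nat \<times> nat \<Rightarrow> complex) \<Rightarrow> complex mat" where
  "gram \<rho> r c H = mat r r (\<lambda>(i,j). (if i = j then 1 else 0) +
     complex_of_real \<rho> * (\<Sum>k<c. H (i,k) * cnj (H (j,k))))"

definition gram_det :: "real \<Rightarrow> nat \<Rightarrow> nat \<Rightarrow> (nat \<times> nat \<Rightarrow> complex) \<Rightarrow> real" where
  "gram_det \<rho> r c H = Re (det (gram \<rho> r c H))"

lemma gram_carrier [simp]: "gram \<rho> r c H \<in> carrier_mat r r"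
  by (simp add: gram_def)

lemma gram_eq_to_mat:
  "1\<^sub>m r + smult_mat (complex_of_real \<rho>) (to_mat r c H * conj_transpose (to_mat r c H)) = gram \<rho> r c H"
  by (rule eq_matI)
     (auto simp: gram_def to_mat_def conj_transpose_def scalar_prod_def lessThan_atLeast0)

lemma det_bordered:
  fixes A :: "nat \<times> nat \<Rightarrow> 'a :: idom"
  assumes y: "\<And>i. i < r \<Longrightarrow> (\<Sum>j<r. A (i,j) * y j) = A (i,r)"
  shows "det (mat (Suc r) (Suc r) A) = (A (r,r) - (\<Sum>j<r. A (r,j) * y j)) * det (mat r r A)"
proof -
  define s where "s = A (r,r) - (\<Sum>j<r. A (r,j) * y j)"
  define B where "B = four_block_mat (1\<^sub>m r) (mat r 1 (\<lambda>(i,j). - y i)) (0\<^sub>m 1 r) (1\<^sub>m 1)"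
  define C where "C = four_block_mat (mat r r A) (0\<^sub>m r 1) (mat 1 r (\<lambda>(i,j). A (r,j))) (mat 1 1 (\<lambda>_. s))"
  have B: "B \<in> carrier_mat (Suc r) (Suc r)" by (rule carrier_matI) (auto simp: B_def)
  have "mat (Suc r) (Suc r) A * B = C"
  proof (rule eq_matI)
    fix i j assume "i < dim_row C" "j < dim_col C"
    then have ij: "i < Suc r" "j < Suc r" by (auto simp: C_def)
    then have "(mat (Suc r) (Suc r) A * B) $$ (i,j) = (\<Sum>k<Suc r. A (i,k) * B $$ (k,j))"
      using B by (auto simp: scalar_prod_def lessThan_atLeast0)
    also have "\<dots> = (\<Sum>k<r. A (i,k) * B $$ (k,j)) + A (i,r) * B $$ (r,j)" by simp
    also have "\<dots> = C $$ (i,j)"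
    proof (cases "j < r")
      case True
      have "(\<Sum>k<r. A (i,k) * B $$ (k,j)) = (\<Sum>k<r. if k = j then A (i,k) else 0)"
        using True by (intro sum.cong) (auto simp: B_def)
      then show ?thesis using True ij by (auto simp: B_def C_def less_Suc_eq)
    next
      case False
      have "(\<Sum>k<r. A (i,k) * B $$ (k,j)) = - (\<Sum>k<r. A (i,k) * y k)"
        using False ij by (subst sum_negf[symmetric], intro sum.cong) (auto simp: B_def)
      then show ?thesis using False ij y
        by (auto simp: B_def C_def less_Suc_eq s_def)
    qed
    finally show "(mat (Suc r) (Suc r) A * B) $$ (i,j) = C $$ (i,j)" .
  qed (use B in \<open>auto simp: C_def\<close>)
  moreover have "det B = 1"
    unfolding B_def by (subst det_four_block_mat_lower_left_zero) auto
  moreover have "det C = det (mat r r A) * s"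
    unfolding C_def by (subst det_four_block_mat_upper_right_zero[of _ r _ 1]) (auto simp: det_single)
  moreover have "det (mat (Suc r) (Suc r) A * B) = det (mat (Suc r) (Suc r) A) * det B"
    using B by (intro det_mult) auto
  ultimately show ?thesis by (simp add: s_def mult.commute)
qed

lemma linear_system_solvable:
  fixes A :: "nat \<times> nat \<Rightarrow> 'a :: field"
  assumes "det (mat r r A) \<noteq> 0"
  obtains y where "\<And>i. i < r \<Longrightarrow> (\<Sum>j<r. A (i,j) * y j) = b i"
proof -
  from det_non_zero_imp_unit[OF _ assms, of r undefined] obtain X where
    X: "X \<in> carrier_mat r r" "mat r r A * X = 1\<^sub>m r"
    unfolding Units_def by (auto simp: ring_mat_def)
  define v where "v = X *\<^sub>v vec r b"
  have "mat r r A *\<^sub>v v = vec r b"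
    unfolding v_def using X by (subst assoc_mult_mat_vec[symmetric, of _ r r]) auto
  moreover have "(mat r r A *\<^sub>v v) $ i = (\<Sum>j<r. A (i,j) * v $ j)" if "i < r" for i
    using that X by (auto simp: v_def scalar_prod_def lessThan_atLeast0)
  ultimately have "(\<Sum>j<r. A (i,j) * v $ j) = b i" if "i < r" for i
    using that by (metis index_vec)
  then show thesis by (rule that)
qed

text \<open>The form splits as \<open>|v|^2 + \<rho> |H^dagger v|^2\<close>. All positivity of Gram
  matrices comes from this: both summands are nonnegative for \<open>0 \<le> \<rho>\<close>, and the
  first is positive for nonzero \<open>v\<close>.\<close>

lemma gram_quadratic_form:
  fixes v :: "nat \<Rightarrow> complex"
  shows "(\<Sum>i<r. \<Sum>j<r. cnj (v i) * gram \<rho> r c H $$ (i,j) * v j) =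
    complex_of_real ((\<Sum>i<r. (cmod (v i))\<^sup>2) + \<rho> * (\<Sum>k<c. (cmod (\<Sum>i<r. cnj (v i) * H (i,k)))\<^sup>2))"
proof -
  have "(\<Sum>i<r. \<Sum>j<r. cnj (v i) * gram \<rho> r c H $$ (i,j) * v j) =
    (\<Sum>i<r. \<Sum>j<r. if i = j then cnj (v i) * v j else 0) +
    (\<Sum>i<r. \<Sum>j<r. \<Sum>k<c. of_real \<rho> * (cnj (v i) * H (i,k) * cnj (H (j,k)) * v j))"
    unfolding sum.distrib[symmetric]
    by (intro sum.cong) (auto simp: gram_def algebra_simps sum_distrib_left)
  also have "(\<Sum>i<r. \<Sum>j<r. if i = j then cnj (v i) * v j else 0) = of_real (\<Sum>i<r. (cmod (v i))\<^sup>2)"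
    by (simp del: of_real_power add: complex_norm_square mult.commute)
  also have "(\<Sum>i<r. \<Sum>j<r. \<Sum>k<c. of_real \<rho> * (cnj (v i) * H (i,k) * cnj (H (j,k)) * v j)) =
     (\<Sum>k<c. \<Sum>i<r. \<Sum>j<r. of_real \<rho> * (cnj (v i) * H (i,k) * cnj (H (j,k)) * v j))"
    by (subst sum.swap[of _ "{..<c}"], subst sum.swap[of _ "{..<c}"]) simp
  also have "\<dots> = (\<Sum>k<c. of_real \<rho> * ((\<Sum>i<r. cnj (v i) * H (i,k)) * cnj (\<Sum>i<r. cnj (v i) * H (i,k))))"
    by (intro sum.cong) (auto simp: sum_distrib_left sum_distrib_right sum_product mult_ac)
  also have "\<dots> = of_real (\<rho> * (\<Sum>k<c. (cmod (\<Sum>i<r. cnj (v i) * H (i,k)))\<^sup>2))"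
    by (simp del: of_real_power cnj_sum add: complex_norm_square sum_distrib_left)
  finally show ?thesis by simp
qed

text \<open>The recursion peels off the Schur complement \<open>s\<close> of the leading block; \<open>s\<close> is the value of the
  quadratic form at a vector with last entry 1, and differs from the corner entry by a nonnegative
  value of the quadratic form of the leading block.\<close>

lemma gram_det_Suc_row:
  assumes rho: "0 \<le> \<rho>" and det: "det (gram \<rho> r c H) = of_real d" "0 < d"
  obtains s where "det (gram \<rho> (Suc r) c H) = of_real (s * d)" "0 < s"
    "s \<le> 1 + \<rho> * (\<Sum>k<c. (cmod (H (r,k)))\<^sup>2)"
proof -
  define A where "A = (\<lambda>(i,j). (if i = j then 1 else 0) +
     complex_of_real \<rho> * (\<Sum>k<c. H (i,k) * cnj (H (j,k))))"
  have gram: "gram \<rho> n c H = mat n n A" for n by (simp add: gram_def A_def)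
  have herm: "A (i,j) = cnj (A (j,i))" for i j
    by (auto simp: A_def mult.commute)
  obtain y where y: "\<And>i. i < r \<Longrightarrow> (\<Sum>j<r. A (i,j) * y j) = A (i,r)"
    using linear_system_solvable[of r A "\<lambda>i. A (i,r)"] det gram by auto
  \<comment> \<open>Since \<open>A y\<close> is the last column, this value of the form at
    \<open>y\<close> is also the term subtracted from the corner entry, which is therefore
    real.\<close>
  define q where "q = (\<Sum>i<r. (cmod (y i))\<^sup>2) + \<rho> * (\<Sum>k<c. (cmod (\<Sum>i<r. cnj (y i) * H (i,k)))\<^sup>2)"
  have q0: "0 \<le> q" unfolding q_def using rho by (intro add_nonneg_nonneg mult_nonneg_nonneg sum_nonneg) auto
  have "of_real q = (\<Sum>i<r. \<Sum>j<r. cnj (y i) * A (i,j) * y j)"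
    unfolding q_def gram_quadratic_form[symmetric] by (intro sum.cong) (auto simp: gram)
  also have "\<dots> = (\<Sum>i<r. cnj (y i) * A (i,r))"
    using y by (intro sum.cong) (auto simp: sum_distrib_left[symmetric] mult.assoc)
  finally have qA: "of_real q = (\<Sum>i<r. cnj (y i) * A (i,r))" .
  have "complex_of_real q = cnj (of_real q)" by simp
  also have "\<dots> = (\<Sum>i<r. A (r,i) * y i)"
    unfolding qA cnj_sum by (intro sum.cong refl) (simp add: herm[of r] mult.commute)
  finally have qA': "(\<Sum>i<r. A (r,i) * y i) = of_real q" by simp
  define p where "p = 1 + \<rho> * (\<Sum>k<c. (cmod (H (r,k)))\<^sup>2)"
  have Arr: "A (r,r) = of_real p"
    by (simp add: A_def p_def complex_norm_square del: of_real_power)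
  define v where "v = (\<lambda>i. if i = r then 1 else - y i)"
  have "of_real ((\<Sum>i<Suc r. (cmod (v i))\<^sup>2) + \<rho> * (\<Sum>k<c. (cmod (\<Sum>i<Suc r. cnj (v i) * H (i,k)))\<^sup>2))
    = (\<Sum>i<Suc r. \<Sum>j<Suc r. cnj (v i) * A (i,j) * v j)"
    unfolding gram_quadratic_form[symmetric] by (intro sum.cong) (auto simp: gram)
  also have "\<dots> = (\<Sum>i<Suc r. cnj (v i) * (A (i,r) - (\<Sum>j<r. A (i,j) * y j)))"
    by (intro sum.cong refl) (simp add: v_def sum_distrib_left sum_negf algebra_simps)
  also have "\<dots> = of_real (p - q)"
    using y by (simp add: v_def qA' Arr)
  finally have pq: "(\<Sum>i<Suc r. (cmod (v i))\<^sup>2) + \<rho> * (\<Sum>k<c. (cmod (\<Sum>i<Suc r. cnj (v i) * H (i,k)))\<^sup>2) = p - q"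
    by (simp only: of_real_eq_iff)
  \<comment> \<open>Strictness comes from the last entry 1 of \<open>v\<close>.\<close>
  have "0 < (\<Sum>i<Suc r. (cmod (v i))\<^sup>2)"
    by (simp add: v_def add_nonneg_pos sum_nonneg)
  moreover have "0 \<le> \<rho> * (\<Sum>k<c. (cmod (\<Sum>i<Suc r. cnj (v i) * H (i,k)))\<^sup>2)"
    using rho by (intro mult_nonneg_nonneg sum_nonneg) auto
  ultimately have "0 < p - q" using pq by linarith
  moreover have "det (gram \<rho> (Suc r) c H) = of_real ((p - q) * d)"
    using det det_bordered[of r A y, OF y] by (simp add: qA' Arr gram)
  ultimately show thesis using that[of "p - q"] q0 by (auto simp: p_def)
qed

text \<open>Induction on the rows from the empty determinant 1, each new row contributing a positive
  Schur complement. Hence taking \<open>Re\<close> of the determinant loses nothing.\<close>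

lemma gram_det_real_pos:
  assumes "0 \<le> \<rho>"
  shows "det (gram \<rho> r c H) = of_real (gram_det \<rho> r c H) \<and> 0 < gram_det \<rho> r c H"
proof (induction r)
  case 0
  show ?case by (simp add: gram_det_def)
next
  case (Suc r)
  then obtain s where s: "det (gram \<rho> (Suc r) c H) = of_real (s * gram_det \<rho> r c H)" "0 < s"
    using gram_det_Suc_row[OF assms] by blast
  then have "gram_det \<rho> (Suc r) c H = s * gram_det \<rho> r c H"
    unfolding gram_det_def[of _ "Suc r"] by (simp only: Re_complex_of_real)
  with s Suc show ?case by simp
qed

text \<open>The Schur complement is at most the corner entry; this is Fischer's inequality for a
  border of one row.\<close>

lemma gram_det_Fischer:
  assumes "0 \<le> \<rho>"
  shows "gram_det \<rho> (Suc r) c H \<le> (1 + \<rho> * (\<Sum>k<c. (cmod (H (r,k)))\<^sup>2)) * gram_det \<rho> r c H"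
proof -
  note D = gram_det_real_pos[OF assms]
  obtain s where "det (gram \<rho> (Suc r) c H) = of_real (s * gram_det \<rho> r c H)"
    "s \<le> 1 + \<rho> * (\<Sum>k<c. (cmod (H (r,k)))\<^sup>2)"
    using gram_det_Suc_row[OF assms] D by metis
  moreover from this(1) have "gram_det \<rho> (Suc r) c H = s * gram_det \<rho> r c H"
    unfolding gram_det_def[of _ "Suc r"] by (simp only: Re_complex_of_real)
  ultimately show ?thesis using D[of r c H] by (auto intro: mult_right_mono)
qed

text \<open>Needed once a column has been rotated onto the last unit vector: the block of the other
  rows no longer sees it.\<close>

lemma gram_Suc_zero_column:
  assumes "\<And>i. i < r \<Longrightarrow> H (i,c) = 0"
  shows "gram \<rho> r (Suc c) H = gram \<rho> r c H"
  using assms by (auto simp: gram_def intro!: eq_matI)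

lemma gram_cong:
  assumes "\<And>i j. i < r \<Longrightarrow> j < c \<Longrightarrow> H (i,j) = H' (i,j)"
  shows "gram \<rho> r c H = gram \<rho> r c H'"
  using assms by (auto simp: gram_def intro!: eq_matI)

lemma gram_det_cong:
  assumes "\<And>i j. i < r \<Longrightarrow> j < c \<Longrightarrow> H (i,j) = H' (i,j)"
  shows "gram_det \<rho> r c H = gram_det \<rho> r c H'"
  using gram_cong[of r c H H', OF assms] by (simp add: gram_det_def)

section \<open>Rotations of two rows\<close>

text \<open>For \<open>(cmod \<alpha>)\<^sup>2 + (cmod \<beta>)\<^sup>2 = 1\<close> this is left
  multiplication by an element of SU(2) acting on rows \<open>p\<close> and \<open>q\<close>. The
  column set \<open>N\<close> is a parameter so that invariance of the measure can be proved one
  column at a time.\<close>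

definition rot_rows :: "complex \<Rightarrow> complex \<Rightarrow> nat \<Rightarrow> nat \<Rightarrow> nat set \<Rightarrow> (nat \<times> nat \<Rightarrow> complex) \<Rightarrow> nat \<times> nat \<Rightarrow> complex" where
  "rot_rows \<alpha> \<beta> p q N H = (\<lambda>(i,j).
     if j \<in> N \<and> i = p then \<alpha> * H (p,j) + \<beta> * H (q,j)
     else if j \<in> N \<and> i = q then - cnj \<beta> * H (p,j) + cnj \<alpha> * H (q,j)
     else H (i,j))"

text \<open>For unitary \<open>U\<close>, passing from \<open>H\<close> to \<open>U H\<close>
  conjugates the Gram matrix by \<open>U\<close>, and
  \<open>det U * det (conj_transpose U) = 1\<close>.\<close>

lemma gram_det_rot_rows:
  assumes pq: "p < r" "q < r" "p \<noteq> q" and ab: "(cmod \<alpha>)\<^sup>2 + (cmod \<beta>)\<^sup>2 = 1" and N: "{..<c} \<subseteq> N"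
  shows "gram_det \<rho> r c (rot_rows \<alpha> \<beta> p q N H) = gram_det \<rho> r c H"
proof -
  define u where "u = (\<lambda>i k. if i = p then (if k = p then \<alpha> else if k = q then \<beta> else 0)
     else if i = q then (if k = p then - cnj \<beta> else if k = q then cnj \<alpha> else 0)
     else if i = k then 1 else 0)"
  have ab': "\<alpha> * cnj \<alpha> + \<beta> * cnj \<beta> = 1"
    using arg_cong[OF ab, of complex_of_real] by (simp add: complex_norm_square del: of_real_power)
  \<comment> \<open>Each row of \<open>U\<close> has at most two nonzero entries; this evaluates
    both \<open>U * T\<close> and \<open>U * conj_transpose U\<close>.\<close>
  have u_sum: "(\<Sum>k<r. u i k * f k) =
      (if i = p then \<alpha> * f p + \<beta> * f q else if i = q then - cnj \<beta> * f p + cnj \<alpha> * f q else f i)"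
    if "i < r" for i and f :: "nat \<Rightarrow> complex"
  proof -
    have "(\<Sum>k<r. u i k * f k) = u i p * f p + (\<Sum>k\<in>{..<r}-{p}. u i k * f k)"
      using pq by (subst sum.remove[of _ p]) auto
    also have "(\<Sum>k\<in>{..<r}-{p}. u i k * f k) = u i q * f q + (\<Sum>k\<in>{..<r}-{p}-{q}. u i k * f k)"
      using pq by (subst sum.remove[of _ q]) auto
    also have "(\<Sum>k\<in>{..<r}-{p}-{q}. u i k * f k) = (if i = p \<or> i = q then 0 else f i)"
    proof (cases "i = p \<or> i = q")
      case True then show ?thesis using pq by (auto intro!: sum.neutral simp: u_def split: if_splits)
    next
      case False
      then have "(\<Sum>k\<in>{..<r}-{p}-{q}. u i k * f k) = (\<Sum>k\<in>{..<r}-{p}-{q}. if i = k then f k else 0)"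
        by (intro sum.cong) (auto simp: u_def)
      with False that show ?thesis by simp
    qed
    finally show ?thesis using pq by (simp add: u_def)
  qed
  define U where "U = mat r r (\<lambda>(i,j). u i j)"
  define T where "T = to_mat r c H"
  have U: "U \<in> carrier_mat r r" and T: "T \<in> carrier_mat r c"
    by (auto simp: U_def T_def to_mat_def)
  have ct: "conj_transpose X \<in> carrier_mat n m" if "X \<in> carrier_mat m n" for X m n
    using that by (auto simp: conj_transpose_def)
  have UT: "to_mat r c (rot_rows \<alpha> \<beta> p q N H) = U * T"
  proof (rule eq_matI)
    fix i j assume "i < dim_row (U * T)" "j < dim_col (U * T)"
    then have ij: "i < r" "j < c" using U T by auto
    have "(U * T) $$ (i,j) = (\<Sum>k<r. u i k * H (k,j))"
      using ij by (auto simp: U_def T_def to_mat_def scalar_prod_def lessThan_atLeast0)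
    then show "to_mat r c (rot_rows \<alpha> \<beta> p q N H) $$ (i,j) = (U * T) $$ (i,j)"
      using ij N by (subst (asm) u_sum) (auto simp: to_mat_def rot_rows_def)
  qed (auto simp: U_def T_def to_mat_def)
  have UU: "U * conj_transpose U = 1\<^sub>m r"
  proof (rule eq_matI)
    fix i j assume ij': "i < dim_row (1\<^sub>m r :: complex mat)" "j < dim_col (1\<^sub>m r :: complex mat)"
    then have ij: "i < r" "j < r" by auto
    have "(U * conj_transpose U) $$ (i,j) = (\<Sum>k<r. u i k * cnj (u j k))"
      using ij by (auto simp: U_def conj_transpose_def scalar_prod_def lessThan_atLeast0)
    also have "\<dots> = (if i = j then 1 else 0)"
      using ij pq ab' by (subst u_sum) (auto simp: u_def algebra_simps)
    finally show "(U * conj_transpose U) $$ (i,j) = 1\<^sub>m r $$ (i,j)"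
      using ij by simp
  qed (auto simp: U_def conj_transpose_def)
  have ct_mult: "conj_transpose (U * T) = conj_transpose T * conj_transpose U"
    using U T by (auto simp: conj_transpose_def scalar_prod_def mult.commute intro!: eq_matI)
  have "gram \<rho> r c (rot_rows \<alpha> \<beta> p q N H) =
    1\<^sub>m r + smult_mat (of_real \<rho>) ((U * T) * (conj_transpose T * conj_transpose U))"
    by (simp add: gram_eq_to_mat[symmetric] UT ct_mult)
  also have "(U * T) * (conj_transpose T * conj_transpose U) = U * (T * conj_transpose T) * conj_transpose U"
    using U T ct[OF U] ct[OF T]
    by (simp add: assoc_mult_mat[of _ r c _ r _ r] assoc_mult_mat[of _ r r _ c _ r] assoc_mult_mat[of _ r r _ r _ r]
        assoc_mult_mat[of U r r T c "conj_transpose T * conj_transpose U" r])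
  also have "1\<^sub>m r + smult_mat (of_real \<rho>) (U * (T * conj_transpose T) * conj_transpose U) =
     U * gram \<rho> r c H * conj_transpose U"
  proof -
    define G where "G = T * conj_transpose T"
    have G: "G \<in> carrier_mat r r" using T ct[OF T] by (auto simp: G_def)
    have "U * (1\<^sub>m r + smult_mat (of_real \<rho>) G) * conj_transpose U =
      (U * 1\<^sub>m r + U * smult_mat (of_real \<rho>) G) * conj_transpose U"
      using U G by (subst mult_add_distrib_mat) auto
    also have "\<dots> = U * conj_transpose U + smult_mat (of_real \<rho>) (U * G) * conj_transpose U"
      using U G ct[OF U] by (subst add_mult_distrib_mat[of _ r r]) (auto simp: mult_smult_distrib[of _ r r _ r])
    also have "\<dots> = 1\<^sub>m r + smult_mat (of_real \<rho>) (U * G * conj_transpose U)"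
      using U G ct[OF U] UU by (auto simp: mult_smult_assoc_mat[of _ r r _ r])
    finally show ?thesis unfolding gram_eq_to_mat[symmetric] T_def[symmetric] G_def by simp
  qed
  finally have "det (gram \<rho> r c (rot_rows \<alpha> \<beta> p q N H)) = det U * det (gram \<rho> r c H) * det (conj_transpose U)"
    using U ct[OF U] by (simp add: det_mult[of _ r])
  also have "\<dots> = det (gram \<rho> r c H) * det (U * conj_transpose U)"
    using U ct[OF U] by (simp add: det_mult[of _ r])
  finally show ?thesis by (simp add: gram_det_def UU)
qed

section \<open>Complex Gaussian measures\<close>

lemma sets_CN01 [measurable_cong, simp]: "sets CN01 = sets borel"
  by (simp add: CN01_def)

lemma space_CN01 [simp]: "space CN01 = UNIV"
  by (simp add: CN01_def)

lemma nn_integral_CN01: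
  assumes [measurable]: "f \<in> borel_measurable borel"
  shows "(\<integral>\<^sup>+z. f z \<partial>CN01) = (\<integral>\<^sup>+z. ennreal (exp (- (cmod z)\<^sup>2) / pi) * f z \<partial>lborel)"
  unfolding CN01_def by (subst nn_integral_density) auto

lemma emeasure_complex_disc:
  "emeasure lborel {z::complex. (cmod z)\<^sup>2 \<le> a} = ennreal (pi * max 0 a)"
proof (cases "a < 0")
  case True
  then have "{z::complex. (cmod z)\<^sup>2 \<le> a} = {}"
    by (auto simp: not_le) (meson le_less_trans less_eq_real_def not_less zero_le_power2 order_trans)
  with True show ?thesis by simp
next
  case False
  have "(cmod z)\<^sup>2 \<le> a \<longleftrightarrow> cmod z \<le> sqrt a" for z
    by (metis abs_norm_cancel real_sqrt_abs real_sqrt_le_iff)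
  then have disc: "{z::complex. (cmod z)\<^sup>2 \<le> a} = cball 0 (sqrt a)"
    by (simp add: cball_def)
  from False show ?thesis
    unfolding disc by (simp add: emeasure_cball unit_ball_vol_2 max_def)
qed

text \<open>A difference of two discs. Clamping with \<open>max 0\<close> keeps the formula valid
  for negative \<open>a\<close>, where nothing is removed, and for \<open>s < a\<close>, where the
  set is empty.\<close>

lemma emeasure_complex_annulus:
  "emeasure lborel {z::complex. a < (cmod z)\<^sup>2 \<and> (cmod z)\<^sup>2 \<le> s} = ennreal (pi * max 0 (s - max 0 a))"
proof (cases "a \<le> s")
  case True
  have "{z::complex. a < (cmod z)\<^sup>2 \<and> (cmod z)\<^sup>2 \<le> s} = {z. (cmod z)\<^sup>2 \<le> s} - {z. (cmod z)\<^sup>2 \<le> a}"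
    by auto
  also have "emeasure lborel \<dots> = emeasure lborel {z::complex. (cmod z)\<^sup>2 \<le> s} - emeasure lborel {z::complex. (cmod z)\<^sup>2 \<le> a}"
    using True by (intro emeasure_Diff) (auto simp: emeasure_complex_disc)
  also have "\<dots> = ennreal (pi * max 0 s - pi * max 0 a)"
    unfolding emeasure_complex_disc by (subst ennreal_minus) auto
  also have "pi * max 0 s - pi * max 0 a = pi * max 0 (s - max 0 a)"
    using True by (auto simp: max_def algebra_simps)
  finally show ?thesis .
next
  case False
  then have empty: "{z::complex. a < (cmod z)\<^sup>2 \<and> (cmod z)\<^sup>2 \<le> s} = {}" by auto
  from False show ?thesis unfolding empty by (simp add: max_def)
qed

lemma nn_integral_exp_tail: "(\<integral>\<^sup>+s. ennreal (exp (- s)) * indicator {q..} s \<partial>lborel) = ennreal (exp (- q))"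
proof -
  have "((\<lambda>s::real. - exp (- s)) \<longlongrightarrow> 0) at_top"
    by real_asymp
  moreover have "((\<lambda>s. - exp (- s)) has_real_derivative exp (- x)) (at x)" for x :: real
    by (auto intro!: derivative_eq_intros)
  ultimately show ?thesis
    using nn_integral_FTC_atLeast[of "\<lambda>s. exp (- s)" q "\<lambda>s. - exp (- s)" 0] by simp
qed

text \<open>\<open>- ((s - b + 1) * exp (- s))\<close> is the antiderivative that vanishes at
  infinity. The weight \<open>s - b\<close> is the area of an annulus up to the factor
  \<open>pi\<close>.\<close>

lemma nn_integral_linear_exp_tail:
  "(\<integral>\<^sup>+s. ennreal ((s - b) * exp (- s)) * indicator {b..} s \<partial>lborel) = ennreal (exp (- b))"
proof -
  have "((\<lambda>s::real. - ((s - b + 1) * exp (- s))) \<longlongrightarrow> 0) at_top"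
    by real_asymp
  moreover have "((\<lambda>s. - ((s - b + 1) * exp (- s))) has_real_derivative (x - b) * exp (- x)) (at x)" for x
    by (auto intro!: derivative_eq_intros simp: algebra_simps)
  ultimately show ?thesis
    using nn_integral_FTC_atLeast[of "\<lambda>s. (s - b) * exp (- s)" b "\<lambda>s. - ((s - b + 1) * exp (- s))" 0] by simp
qed

text \<open>Layer-cake: \<open>exp (-q)\<close> is the integral of \<open>exp (-s)\<close> over \<open>s \<ge> q\<close>, so that swapping the
  integrals leaves the areas of annuli.\<close>

lemma emeasure_CN01_gt:
  "emeasure CN01 {z. a < (cmod z)\<^sup>2} = ennreal (exp (- max 0 a))"
proof -
  have "emeasure CN01 {z. a < (cmod z)\<^sup>2} = (\<integral>\<^sup>+z. indicator {z. a < (cmod z)\<^sup>2} z \<partial>CN01)"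
    by (subst nn_integral_indicator) auto
  also have "\<dots> = (\<integral>\<^sup>+z. ennreal (1/pi) * ((\<integral>\<^sup>+s. ennreal (exp (- s)) * indicator {(cmod z)\<^sup>2..} s \<partial>lborel) *
      indicator {z. a < (cmod z)\<^sup>2} z) \<partial>lborel)"
    by (subst nn_integral_CN01) (auto simp: nn_integral_exp_tail ennreal_mult'[symmetric] mult.assoc[symmetric]
        intro!: nn_integral_cong)
  also have "\<dots> = ennreal (1/pi) * (\<integral>\<^sup>+z. (\<integral>\<^sup>+s. ennreal (exp (- s)) * indicator {(cmod z)\<^sup>2..} s \<partial>lborel) *
      indicator {z. a < (cmod z)\<^sup>2} z \<partial>lborel)"
    by (subst nn_integral_cmult) (auto simp: nn_integral_exp_tail)
  also have "(\<integral>\<^sup>+z. (\<integral>\<^sup>+s. ennreal (exp (- s)) * indicator {(cmod z)\<^sup>2..} s \<partial>lborel) *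
      indicator {z. a < (cmod z)\<^sup>2} z \<partial>lborel) =
    (\<integral>\<^sup>+z. (\<integral>\<^sup>+s. ennreal (exp (- s)) * indicator {z. a < (cmod z)\<^sup>2 \<and> (cmod z)\<^sup>2 \<le> s} z \<partial>lborel) \<partial>lborel)"
    by (intro nn_integral_cong, subst nn_integral_multc[symmetric])
       (auto intro!: nn_integral_cong split: split_indicator)
  also have "\<dots> = (\<integral>\<^sup>+s. (\<integral>\<^sup>+z. ennreal (exp (- s)) * indicator {z::complex. a < (cmod z)\<^sup>2 \<and> (cmod z)\<^sup>2 \<le> s} z \<partial>lborel) \<partial>lborel)"
    by (rule lborel_pair.Fubini') (simp add: case_prod_unfold indicator_def)
  also have "\<dots> = (\<integral>\<^sup>+s. ennreal (exp (- s)) * ennreal (pi * max 0 (s - max 0 a)) \<partial>lborel)"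
    by (intro nn_integral_cong, subst nn_integral_cmult_indicator) (auto simp: emeasure_complex_annulus)
  also have "\<dots> = (\<integral>\<^sup>+s. ennreal pi * (ennreal ((s - max 0 a) * exp (- s)) * indicator {max 0 a..} s) \<partial>lborel)"
    by (intro nn_integral_cong)
       (auto simp: ennreal_mult'[symmetric] max_def mult_ac split: split_indicator)
  also have "\<dots> = ennreal pi * ennreal (exp (- max 0 a))"
    by (subst nn_integral_cmult) (auto simp: nn_integral_linear_exp_tail)
  also have "ennreal (1/pi) * \<dots> = ennreal (exp (- max 0 a))"
    by (simp add: ennreal_mult'[symmetric])
  finally show ?thesis .
qed

lemma prob_space_CN01: "prob_space CN01"
proof
  \<comment> \<open>A negative threshold excludes no point, so the tail formula gives the total mass
    \<open>exp 0\<close>.\<close>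
  have "{z::complex. -1 < (cmod z)\<^sup>2} = UNIV"
    by (auto intro: less_le_trans[of _ 0])
  then show "emeasure CN01 (space CN01) = 1"
    using emeasure_CN01_gt[of "-1"] by simp
qed

interpretation CN01: prob_space CN01
  by (rule prob_space_CN01)

lemma CN01_norm_square_exponential:
  "distributed CN01 lborel (\<lambda>z. (cmod z)\<^sup>2) (exponential_density 1)"
proof (rule exponential_distributedI)
  fix a :: real assume a: "0 \<le> a"
  have "{z \<in> space CN01. (cmod z)\<^sup>2 \<le> a} = space CN01 - {z. a < (cmod z)\<^sup>2}" by auto
  also have "emeasure CN01 \<dots> = 1 - ennreal (exp (- a * 1))"
    using a by (subst emeasure_compl) (auto simp: emeasure_CN01_gt CN01.emeasure_space_1[simplified])
  finally show "emeasure CN01 {z \<in> space CN01. (cmod z)\<^sup>2 \<le> a} = 1 - ennreal (exp (- a * 1))" .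
qed auto

section \<open>Unitary invariance of the Gaussian law\<close>

lemma nn_integral_lborel_translate:
  fixes f :: "'a::euclidean_space \<Rightarrow> ennreal"
  assumes [measurable]: "f \<in> borel_measurable borel"
  shows "(\<integral>\<^sup>+x. f (x + t) \<partial>lborel) = (\<integral>\<^sup>+x. f x \<partial>lborel)"
proof -
  have "(\<integral>\<^sup>+x. f x \<partial>lborel) = (\<integral>\<^sup>+x. f x \<partial>distr lborel borel ((+) t))"
    by (simp add: lborel_distr_plus)
  also have "\<dots> = (\<integral>\<^sup>+x. f (x + t) \<partial>lborel)"
    by (subst nn_integral_distr) (auto simp: add.commute)
  finally show ?thesis ..
qed

text \<open>For fixed \<open>w\<close> the shear is a translation in \<open>z\<close>, so the
  integral over \<open>z\<close> is made the inner one first.\<close>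

lemma nn_integral_lborel_shear_fst:
  fixes f :: "complex \<Rightarrow> complex \<Rightarrow> ennreal"
  assumes [measurable]: "case_prod f \<in> borel_measurable (borel \<Otimes>\<^sub>M borel)"
  shows "(\<integral>\<^sup>+z. \<integral>\<^sup>+w. f (z + t * w) w \<partial>lborel \<partial>lborel) = (\<integral>\<^sup>+z. \<integral>\<^sup>+w. f z w \<partial>lborel \<partial>lborel)"
proof -
  have "(\<integral>\<^sup>+z. \<integral>\<^sup>+w. f (z + t * w) w \<partial>lborel \<partial>lborel) = (\<integral>\<^sup>+w. \<integral>\<^sup>+z. f (z + t * w) w \<partial>lborel \<partial>lborel)"
    by (rule lborel_pair.Fubini') simp
  also have "\<dots> = (\<integral>\<^sup>+w. \<integral>\<^sup>+z. f z w \<partial>lborel \<partial>lborel)"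
    by (intro nn_integral_cong nn_integral_lborel_translate[of "\<lambda>z. f z _"]) simp
  also have "\<dots> = (\<integral>\<^sup>+z. \<integral>\<^sup>+w. f z w \<partial>lborel \<partial>lborel)"
    by (rule lborel_pair.Fubini'[symmetric]) simp
  finally show ?thesis .
qed

lemma nn_integral_lborel_shear_snd:
  fixes f :: "complex \<Rightarrow> complex \<Rightarrow> ennreal"
  assumes [measurable]: "case_prod f \<in> borel_measurable (borel \<Otimes>\<^sub>M borel)"
  shows "(\<integral>\<^sup>+z. \<integral>\<^sup>+w. f z (w + t * z) \<partial>lborel \<partial>lborel) = (\<integral>\<^sup>+z. \<integral>\<^sup>+w. f z w \<partial>lborel \<partial>lborel)"
  by (intro nn_integral_cong nn_integral_lborel_translate) simp

text \<open>A matrix of determinant 1 with nonzero lower left entry is a product of three shears.\<close>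

lemma nn_integral_lborel_SL2:
  fixes f :: "complex \<Rightarrow> complex \<Rightarrow> ennreal"
  assumes [measurable]: "case_prod f \<in> borel_measurable (borel \<Otimes>\<^sub>M borel)"
    and det: "\<alpha> * \<delta> - \<beta> * \<gamma> = 1" and "\<gamma> \<noteq> 0"
  shows "(\<integral>\<^sup>+z. \<integral>\<^sup>+w. f (\<alpha> * z + \<beta> * w) (\<gamma> * z + \<delta> * w) \<partial>lborel \<partial>lborel) =
    (\<integral>\<^sup>+z. \<integral>\<^sup>+w. f z w \<partial>lborel \<partial>lborel)"
proof -
  \<comment> \<open>Multiplying out the shears with parameters \<open>a\<close>,
    \<open>\<gamma>\<close>, \<open>b\<close> gives the lower left entry \<gamma> and the diagonal
    entries \<open>1 + a * \<gamma>\<close> and \<open>1 + b * \<gamma>\<close>, which forces these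
    values. The upper right entry is then \<beta> because the determinant is 1.\<close>
  define a b where "a = (\<alpha> - 1) / \<gamma>" and "b = (\<delta> - 1) / \<gamma>"
  define g1 where "g1 = (\<lambda>z w. f (z + a * w) w)"
  define g2 where "g2 = (\<lambda>z w. g1 z (w + \<gamma> * z))"
  have [measurable]: "case_prod g1 \<in> borel_measurable (borel \<Otimes>\<^sub>M borel)"
    unfolding g1_def by measurable
  have [measurable]: "case_prod g2 \<in> borel_measurable (borel \<Otimes>\<^sub>M borel)"
    unfolding g2_def by measurable
  have snd: "w + \<gamma> * (z + b * w) = \<gamma> * z + \<delta> * w" for z w
    using \<open>\<gamma> \<noteq> 0\<close> by (simp add: b_def field_simps)
  have fst: "z + b * w + a * (\<gamma> * z + \<delta> * w) = \<alpha> * z + \<beta> * w" for z w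
  proof -
    have "\<gamma> * (z + b * w + a * (\<gamma> * z + \<delta> * w)) = \<gamma> * z + (\<delta> - 1) * w + (\<alpha> - 1) * (\<gamma> * z + \<delta> * w)"
      using \<open>\<gamma> \<noteq> 0\<close> by (simp add: a_def b_def field_simps)
    also have "\<dots> = \<gamma> * (\<alpha> * z) + (\<alpha> * \<delta> - 1) * w"
      by (simp add: algebra_simps)
    also have "\<alpha> * \<delta> - 1 = \<beta> * \<gamma>"
      using det by (simp add: algebra_simps)
    also have "\<gamma> * (\<alpha> * z) + \<beta> * \<gamma> * w = \<gamma> * (\<alpha> * z + \<beta> * w)"
      by (simp add: algebra_simps)
    finally show ?thesis using \<open>\<gamma> \<noteq> 0\<close> by simp
  qed
  have "(\<integral>\<^sup>+z. \<integral>\<^sup>+w. f (\<alpha> * z + \<beta> * w) (\<gamma> * z + \<delta> * w) \<partial>lborel \<partial>lborel) =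
     (\<integral>\<^sup>+z. \<integral>\<^sup>+w. g2 (z + b * w) w \<partial>lborel \<partial>lborel)"
    by (simp add: g2_def g1_def fst snd)
  also have "\<dots> = (\<integral>\<^sup>+z. \<integral>\<^sup>+w. g2 z w \<partial>lborel \<partial>lborel)"
    by (rule nn_integral_lborel_shear_fst) simp
  also have "\<dots> = (\<integral>\<^sup>+z. \<integral>\<^sup>+w. g1 z w \<partial>lborel \<partial>lborel)"
    unfolding g2_def by (rule nn_integral_lborel_shear_snd) simp
  also have "\<dots> = (\<integral>\<^sup>+z. \<integral>\<^sup>+w. f z w \<partial>lborel \<partial>lborel)"
    unfolding g1_def by (rule nn_integral_lborel_shear_fst) simp
  finally show ?thesis .
qed

lemma norm_square_rotation:
  assumes "(cmod \<alpha>)\<^sup>2 + (cmod \<beta>)\<^sup>2 = 1"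
  shows "(cmod (\<alpha> * z + \<beta> * w))\<^sup>2 + (cmod (- cnj \<beta> * z + cnj \<alpha> * w))\<^sup>2 = (cmod z)\<^sup>2 + (cmod w)\<^sup>2"
proof -
  have ab: "\<alpha> * cnj \<alpha> + \<beta> * cnj \<beta> = 1"
    using arg_cong[OF assms, of complex_of_real] by (simp add: complex_norm_square del: of_real_power)
  have "complex_of_real ((cmod (\<alpha> * z + \<beta> * w))\<^sup>2 + (cmod (- cnj \<beta> * z + cnj \<alpha> * w))\<^sup>2) =
    (\<alpha> * z + \<beta> * w) * (cnj \<alpha> * cnj z + cnj \<beta> * cnj w) + (- cnj \<beta> * z + cnj \<alpha> * w) * (- \<beta> * cnj z + \<alpha> * cnj w)"
    by (simp add: complex_norm_square del: of_real_power)
  also have "\<dots> = (\<alpha> * cnj \<alpha> + \<beta> * cnj \<beta>) * (z * cnj z + w * cnj w)"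
    by (simp add: algebra_simps)
  also have "\<dots> = z * cnj z + w * cnj w"
    by (simp add: ab)
  also have "\<dots> = complex_of_real ((cmod z)\<^sup>2 + (cmod w)\<^sup>2)"
    by (simp add: complex_norm_square del: of_real_power)
  finally show ?thesis by (simp only: of_real_eq_iff)
qed

text \<open>The joint density depends only on \<open>(cmod z)\<^sup>2 + (cmod w)\<^sup>2\<close>,
  which the rotation preserves, and the rotation has determinant 1. Its lower left entry is
  \<open>- cnj \<beta>\<close>, so \<open>\<beta> \<noteq> 0\<close> is what the factorization into
  shears asks for.\<close>

lemma nn_integral_CN01_rotation:
  fixes f :: "complex \<Rightarrow> complex \<Rightarrow> ennreal"
  assumes f[measurable]: "case_prod f \<in> borel_measurable (borel \<Otimes>\<^sub>M borel)"
    and ab: "(cmod \<alpha>)\<^sup>2 + (cmod \<beta>)\<^sup>2 = 1" and "\<beta> \<noteq> 0"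
  shows "(\<integral>\<^sup>+z. \<integral>\<^sup>+w. f (\<alpha> * z + \<beta> * w) (- cnj \<beta> * z + cnj \<alpha> * w) \<partial>CN01 \<partial>CN01) =
    (\<integral>\<^sup>+z. \<integral>\<^sup>+w. f z w \<partial>CN01 \<partial>CN01)"
proof -
  define \<phi> where "\<phi> z w = ennreal (exp (- ((cmod z)\<^sup>2 + (cmod w)\<^sup>2)) / pi\<^sup>2)" for z w
  have [measurable]: "case_prod \<phi> \<in> borel_measurable (borel \<Otimes>\<^sub>M borel)"
    unfolding \<phi>_def by measurable
  have gauss: "(\<integral>\<^sup>+z. \<integral>\<^sup>+w. g z w \<partial>CN01 \<partial>CN01) = (\<integral>\<^sup>+z. \<integral>\<^sup>+w. \<phi> z w * g z w \<partial>lborel \<partial>lborel)"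
    if [measurable]: "case_prod g \<in> borel_measurable (borel \<Otimes>\<^sub>M borel)" for g
  proof -
    have "(\<integral>\<^sup>+z. \<integral>\<^sup>+w. g z w \<partial>CN01 \<partial>CN01) = (\<integral>\<^sup>+z. \<integral>\<^sup>+w. ennreal (exp (- (cmod w)\<^sup>2) / pi) * g z w \<partial>lborel \<partial>CN01)"
      by (intro nn_integral_cong nn_integral_CN01) simp
    also have "\<dots> = (\<integral>\<^sup>+z. ennreal (exp (- (cmod z)\<^sup>2) / pi) * (\<integral>\<^sup>+w. ennreal (exp (- (cmod w)\<^sup>2) / pi) * g z w \<partial>lborel) \<partial>lborel)"
      by (intro nn_integral_CN01) measurable
    also have "\<dots> = (\<integral>\<^sup>+z. \<integral>\<^sup>+w. \<phi> z w * g z w \<partial>lborel \<partial>lborel)"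
    proof (intro nn_integral_cong)
      fix z :: complex
      have "ennreal (exp (- (cmod z)\<^sup>2) / pi) * (ennreal (exp (- (cmod w)\<^sup>2) / pi) * g z w) = \<phi> z w * g z w" for w
      proof -
        have "exp (- (cmod z)\<^sup>2) / pi * (exp (- (cmod w)\<^sup>2) / pi) = exp (- ((cmod z)\<^sup>2 + (cmod w)\<^sup>2)) / pi\<^sup>2"
          by (simp add: exp_diff exp_minus power2_eq_square divide_simps)
        then show ?thesis
          by (simp add: \<phi>_def mult.assoc[symmetric] ennreal_mult'[symmetric])
      qed
      moreover have "(\<lambda>w. ennreal (exp (- (cmod w)\<^sup>2) / pi) * g z w) \<in> borel_measurable lborel"
        by measurable
      ultimately show "ennreal (exp (- (cmod z)\<^sup>2) / pi) * (\<integral>\<^sup>+w. ennreal (exp (- (cmod w)\<^sup>2) / pi) * g z w \<partial>lborel) =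
          (\<integral>\<^sup>+w. \<phi> z w * g z w \<partial>lborel)"
        by (simp add: nn_integral_cmult[symmetric])
    qed
    finally show ?thesis .
  qed
  have det: "\<alpha> * cnj \<alpha> - \<beta> * - cnj \<beta> = 1"
    using arg_cong[OF ab, of complex_of_real] by (simp add: complex_norm_square del: of_real_power)
  have "(\<integral>\<^sup>+z. \<integral>\<^sup>+w. f (\<alpha> * z + \<beta> * w) (- cnj \<beta> * z + cnj \<alpha> * w) \<partial>CN01 \<partial>CN01) =
    (\<integral>\<^sup>+z. \<integral>\<^sup>+w. \<phi> (\<alpha> * z + \<beta> * w) (- cnj \<beta> * z + cnj \<alpha> * w) * f (\<alpha> * z + \<beta> * w) (- cnj \<beta> * z + cnj \<alpha> * w) \<partial>lborel \<partial>lborel)"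
    unfolding \<phi>_def norm_square_rotation[OF ab] by (subst gauss) (auto simp: \<phi>_def)
  also have "\<dots> = (\<integral>\<^sup>+z. \<integral>\<^sup>+w. \<phi> z w * f z w \<partial>lborel \<partial>lborel)"
    using \<open>\<beta> \<noteq> 0\<close> by (intro nn_integral_lborel_SL2[of "\<lambda>z w. \<phi> z w * f z w", OF _ det]) auto
  also have "\<dots> = (\<integral>\<^sup>+z. \<integral>\<^sup>+w. f z w \<partial>CN01 \<partial>CN01)"
    by (rule gauss[symmetric]) simp
  finally show ?thesis .
qed

interpretation CN01_PiM: product_sigma_finite "\<lambda>_. CN01"
  by standard

lemma measurable_PiM_CN01_rotation:
  assumes "p \<in> I" "q \<in> I"
  shows "(\<lambda>x. x(p := \<alpha> * x p + \<beta> * x q, q := - cnj \<beta> * x p + cnj \<alpha> * x q)) \<in>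
      PiM I (\<lambda>_. CN01) \<rightarrow>\<^sub>M PiM I (\<lambda>_. CN01)"
proof -
  have [measurable]: "(\<lambda>x. x p) \<in> PiM I (\<lambda>_. CN01) \<rightarrow>\<^sub>M borel" "(\<lambda>x. x q) \<in> PiM I (\<lambda>_. CN01) \<rightarrow>\<^sub>M borel"
    using measurable_component_singleton[OF \<open>p \<in> I\<close>, of "\<lambda>_. CN01"]
      measurable_component_singleton[OF \<open>q \<in> I\<close>, of "\<lambda>_. CN01"]
    by (simp_all cong: measurable_cong_sets)
  show ?thesis
    by (rule measurable_fun_upd[where J=I], use assms in blast, rule measurable_fun_upd[where J=I])
       (use assms in auto)
qed

text \<open>By Fubini all coordinates except \<open>p\<close> and \<open>q\<close> can be frozen,
  which leaves the two-dimensional rotation.\<close>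

lemma nn_integral_PiM_CN01_rotation:
  assumes "finite I" "p \<in> I" "q \<in> I" "p \<noteq> q"
    and f[measurable]: "f \<in> borel_measurable (PiM I (\<lambda>_. CN01))"
    and ab: "(cmod \<alpha>)\<^sup>2 + (cmod \<beta>)\<^sup>2 = 1" and "\<beta> \<noteq> 0"
  shows "(\<integral>\<^sup>+x. f (x(p := \<alpha> * x p + \<beta> * x q, q := - cnj \<beta> * x p + cnj \<alpha> * x q)) \<partial>PiM I (\<lambda>_. CN01)) =
    (\<integral>\<^sup>+x. f x \<partial>PiM I (\<lambda>_. CN01))"
proof -
  define J where "J = I - {p, q}"
  have I: "I = insert q (insert p J)" and J: "finite J" "p \<notin> J" "q \<notin> insert p J"
    using assms by (auto simp: J_def)
  have split: "(\<integral>\<^sup>+x. g x \<partial>PiM I (\<lambda>_. CN01)) = (\<integral>\<^sup>+x. \<integral>\<^sup>+z. \<integral>\<^sup>+w. g (x(p := z, q := w)) \<partial>CN01 \<partial>CN01 \<partial>PiM J (\<lambda>_. CN01))"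
    if [measurable]: "g \<in> borel_measurable (PiM I (\<lambda>_. CN01))" for g :: "_ \<Rightarrow> ennreal"
  proof -
    have g: "g \<in> borel_measurable (PiM (insert q (insert p J)) (\<lambda>_. CN01))" using that I by simp
    have "(\<integral>\<^sup>+x. g x \<partial>PiM I (\<lambda>_. CN01)) = (\<integral>\<^sup>+x. \<integral>\<^sup>+w. g (x(q := w)) \<partial>CN01 \<partial>PiM (insert p J) (\<lambda>_. CN01))"
      unfolding I using J g by (subst CN01_PiM.product_nn_integral_insert) auto
    also have "\<dots> = (\<integral>\<^sup>+x. \<integral>\<^sup>+z. \<integral>\<^sup>+w. g (x(p := z, q := w)) \<partial>CN01 \<partial>CN01 \<partial>PiM J (\<lambda>_. CN01))"
    proof (subst CN01_PiM.product_nn_integral_insert)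
      have "(\<lambda>(x, w). g (x(q := w))) \<in> borel_measurable (PiM (insert p J) (\<lambda>_. CN01) \<Otimes>\<^sub>M CN01)"
        unfolding case_prod_unfold
        by (rule measurable_compose[OF measurable_fun_upd g]) auto
      then show "(\<lambda>x. \<integral>\<^sup>+w. g (x(q := w)) \<partial>CN01) \<in> borel_measurable (PiM (insert p J) (\<lambda>_. CN01))"
        by (rule CN01.borel_measurable_nn_integral)
    qed (use J in auto)
    finally show ?thesis .
  qed
  note upd = measurable_PiM_CN01_rotation[OF assms(2,3), of \<alpha> \<beta>]
  have rot: "(\<integral>\<^sup>+z. \<integral>\<^sup>+w. f (x(p := \<alpha> * z + \<beta> * w, q := - cnj \<beta> * z + cnj \<alpha> * w)) \<partial>CN01 \<partial>CN01) =
      (\<integral>\<^sup>+z. \<integral>\<^sup>+w. f (x(p := z, q := w)) \<partial>CN01 \<partial>CN01)"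
    if x: "x \<in> space (PiM J (\<lambda>_. CN01))" for x
  proof -
    have "(\<lambda>zw. x(p := fst zw, q := snd zw)) \<in> borel \<Otimes>\<^sub>M borel \<rightarrow>\<^sub>M PiM I (\<lambda>_. CN01)"
      unfolding I
      by (rule measurable_fun_upd[where J="insert p J"], blast, rule measurable_fun_upd[where J=J], blast)
         (use x in auto)
    from measurable_compose[OF this f]
    have "case_prod (\<lambda>z w. f (x(p := z, q := w))) \<in> borel_measurable (borel \<Otimes>\<^sub>M borel)"
      by (simp add: case_prod_unfold)
    from nn_integral_CN01_rotation[OF this ab \<open>\<beta> \<noteq> 0\<close>] show ?thesis .
  qed
  have upd2: "(x(p := z, q := w))(p := s, q := t) = x(p := s, q := t)" for x :: "'a \<Rightarrow> complex" and z w s t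
    by auto
  have "(\<integral>\<^sup>+x. f (x(p := \<alpha> * x p + \<beta> * x q, q := - cnj \<beta> * x p + cnj \<alpha> * x q)) \<partial>PiM I (\<lambda>_. CN01)) =
    (\<integral>\<^sup>+x. \<integral>\<^sup>+z. \<integral>\<^sup>+w. f (x(p := \<alpha> * z + \<beta> * w, q := - cnj \<beta> * z + cnj \<alpha> * w)) \<partial>CN01 \<partial>CN01 \<partial>PiM J (\<lambda>_. CN01))"
    unfolding split[OF measurable_compose[OF upd f]] upd2 using \<open>p \<noteq> q\<close> by simp
  also have "\<dots> = (\<integral>\<^sup>+x. \<integral>\<^sup>+z. \<integral>\<^sup>+w. f (x(p := z, q := w)) \<partial>CN01 \<partial>CN01 \<partial>PiM J (\<lambda>_. CN01))"
    by (intro nn_integral_cong rot)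
  also have "\<dots> = (\<integral>\<^sup>+x. f x \<partial>PiM I (\<lambda>_. CN01))"
    by (rule split[OF f, symmetric])
  finally show ?thesis .
qed

text \<open>Induction on the set of columns: rotations in different columns act on disjoint pairs of
  coordinates, so each new column adds one rotation \<open>U\<close> of two coordinates of the
  product measure.\<close>

lemma nn_integral_rot_rows:
  assumes pq: "p < r" "q < r" "p \<noteq> q" and N: "finite N" "N \<subseteq> {..<c}"
    and f: "f \<in> borel_measurable (PiM ({..<r} \<times> {..<c}) (\<lambda>_. CN01))"
    and ab: "(cmod \<alpha>)\<^sup>2 + (cmod \<beta>)\<^sup>2 = 1" "\<beta> \<noteq> 0"
  shows "(\<integral>\<^sup>+x. f (rot_rows \<alpha> \<beta> p q N x) \<partial>PiM ({..<r} \<times> {..<c}) (\<lambda>_. CN01)) =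
    (\<integral>\<^sup>+x. f x \<partial>PiM ({..<r} \<times> {..<c}) (\<lambda>_. CN01))"
  using N f
proof (induction N arbitrary: f rule: finite_induct)
  case empty
  then show ?case by (simp add: rot_rows_def case_prod_eta)
next
  case (insert n N)
  let ?M = "PiM ({..<r} \<times> {..<c}) (\<lambda>_. CN01)"
  define U where "U = (\<lambda>x :: nat \<times> nat \<Rightarrow> complex. x((p,n) := \<alpha> * x (p,n) + \<beta> * x (q,n), (q,n) := - cnj \<beta> * x (p,n) + cnj \<alpha> * x (q,n)))"
  have n: "(p,n) \<in> {..<r} \<times> {..<c}" "(q,n) \<in> {..<r} \<times> {..<c}" using insert pq by auto
  have U: "U \<in> ?M \<rightarrow>\<^sub>M ?M"
    unfolding U_def using n by (rule measurable_PiM_CN01_rotation)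
  have "rot_rows \<alpha> \<beta> p q (insert n N) x = U (rot_rows \<alpha> \<beta> p q N x)" for x
    using insert.hyps pq by (auto simp: rot_rows_def U_def fun_eq_iff)
  then have "(\<integral>\<^sup>+x. f (rot_rows \<alpha> \<beta> p q (insert n N) x) \<partial>?M) = (\<integral>\<^sup>+x. f (U (rot_rows \<alpha> \<beta> p q N x)) \<partial>?M)"
    by simp
  also have "\<dots> = (\<integral>\<^sup>+x. f (U x) \<partial>?M)"
    using insert.prems U by (intro insert.IH[of "\<lambda>x. f (U x)"]) (auto intro: measurable_compose)
  also have "\<dots> = (\<integral>\<^sup>+x. f x \<partial>?M)"
    unfolding U_def using pq n insert.prems ab by (intro nn_integral_PiM_CN01_rotation) auto
  finally show ?case .
qed

section \<open>The incomplete gamma function as a distribution function\<close>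

text \<open>\<open>erlang_density k 1\<close> is the Gamma density of shape \<open>k + 1\<close>,
  which is why the second argument of \<open>Gamma_inc\<close> is written
  \<open>Suc k\<close>.\<close>

lemma Gamma_inc_eq_erlang:
  assumes "0 \<le> x"
  shows "ennreal (Gamma_inc x (Suc k)) = (\<integral>\<^sup>+s. ennreal (erlang_density k 1 s) * indicator {..<x} s \<partial>lborel)"
    and "0 \<le> Gamma_inc x (Suc k)"
proof -
  have G: "Gamma_inc x (Suc k) = (\<integral>t. 1 / fact k * (t ^ k * exp (- t)) * indicator {0<..<x} t \<partial>lborel)"
  proof -
    have "(LBINT t=0..x. t ^ k * exp (- t)) = (\<integral>t. t ^ k * exp (- t) * indicator {0<..<x} t \<partial>lborel)"
      using assms by (simp add: interval_lebesgue_integral_def einterval_eq set_lebesgue_integral_def mult.commute zero_ereal_def)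
    then show ?thesis by (simp add: Gamma_inc_def mult.assoc)
  qed
  have int: "integrable lborel (\<lambda>t. 1 / fact k * (t ^ k * exp (- t)) * indicator {0<..<x} t)"
  proof -
    have "integrable lborel (\<lambda>t. indicator {0..x} t *\<^sub>R (1 / fact k * (t ^ k * exp (- t))))"
      by (rule borel_integrable_compact) (auto intro!: continuous_intros)
    then have "set_integrable lborel {0..x} (\<lambda>t. 1 / fact k * (t ^ k * exp (- t)))"
      by (simp add: set_integrable_def)
    then have "set_integrable lborel {0<..<x} (\<lambda>t. 1 / fact k * (t ^ k * exp (- t)))"
      by (rule set_integrable_subset) auto
    then show ?thesis by (simp add: set_integrable_def mult_ac)
  qed
  have nonneg: "0 \<le> 1 / fact k * (t ^ k * exp (- t)) * indicator {0<..<x} t" for t :: real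
    by (auto split: split_indicator)
  show "0 \<le> Gamma_inc x (Suc k)"
    unfolding G by (intro integral_nonneg_AE) (use nonneg in auto)
  have "ennreal (Gamma_inc x (Suc k)) = (\<integral>\<^sup>+t. ennreal (1 / fact k * (t ^ k * exp (- t)) * indicator {0<..<x} t) \<partial>lborel)"
    unfolding G by (rule nn_integral_eq_integral[symmetric, OF int]) (use nonneg in auto)
  also have "\<dots> = (\<integral>\<^sup>+s. ennreal (erlang_density k 1 s) * indicator {..<x} s \<partial>lborel)"
    \<comment> \<open>The interval integral omits 0, where the density for \<open>k = 0\<close>
      equals 1; a single point has measure zero.\<close>
    using AE_lborel_singleton[of "0::real"]
    by (intro nn_integral_cong_AE, eventually_elim) (auto simp: erlang_density_def split: split_indicator)
  finally show "ennreal (Gamma_inc x (Suc k)) = (\<integral>\<^sup>+s. ennreal (erlang_density k 1 s) * indicator {..<x} s \<partial>lborel)" .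
qed

text \<open>The squared moduli of the coordinates are independent unit exponentials, so their sum
  over \<open>Suc k\<close> coordinates is Erlang of shape \<open>k + 1\<close>.\<close>

lemma emeasure_PiM_CN01_norm_square_less:
  assumes K: "finite K" "card K = Suc k" and x: "0 \<le> x"
  shows "emeasure (PiM K (\<lambda>_. CN01)) {a \<in> space (PiM K (\<lambda>_. CN01)). (\<Sum>p\<in>K. (cmod (a p))\<^sup>2) < x}
    = ennreal (Gamma_inc x (Suc k))"
proof -
  let ?P = "PiM K (\<lambda>_. CN01)"
  interpret P: prob_space ?P by (intro prob_space_PiM prob_space_CN01)
  have ne: "K \<noteq> {}" using K by auto
  have comp: "(\<lambda>a. a p) \<in> ?P \<rightarrow>\<^sub>M CN01" if "p \<in> K" for p
    using measurable_component_singleton[OF that, of "\<lambda>_. CN01"] by simp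
  have compd: "distr ?P CN01 (\<lambda>a. a p) = CN01" if "p \<in> K" for p
    using K that by (intro distr_PiM_component prob_space_CN01) auto
  \<comment> \<open>Independence of the coordinates: their joint law, which is the law of the
    identity, is the product of the marginals.\<close>
  have "distr ?P ?P (\<lambda>a. \<lambda>p\<in>K. a p) = distr ?P ?P (\<lambda>a. a)"
    by (intro distr_cong) (auto simp: space_PiM PiE_def extensional_restrict)
  also have "\<dots> = ?P" by (simp add: distr_id2)
  also have "\<dots> = PiM K (\<lambda>p. distr ?P CN01 (\<lambda>a. a p))"
    by (intro PiM_cong) (auto simp: compd)
  finally have "P.indep_vars (\<lambda>_. CN01) (\<lambda>p a. a p) K"
    using comp by (subst P.indep_vars_iff_distr_eq_PiM'[OF ne]) auto
  then have indep: "P.indep_vars (\<lambda>_. borel) (\<lambda>p a. (cmod (a p))\<^sup>2) K"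
    by (rule P.indep_vars_compose2[where Y="\<lambda>_ z. (cmod z)\<^sup>2"]) auto
  have "distributed ?P lborel (\<lambda>a. (cmod (a p))\<^sup>2) (exponential_density 1)" if "p \<in> K" for p
  proof -
    have "distr ?P lborel (\<lambda>a. (cmod (a p))\<^sup>2) = distr (distr ?P CN01 (\<lambda>a. a p)) lborel (\<lambda>z. (cmod z)\<^sup>2)"
      using comp[OF that] by (subst distr_distr) (auto simp: comp_def)
    then show ?thesis
      using CN01_norm_square_exponential comp[OF that] unfolding compd[OF that] distributed_def
      by (auto intro: measurable_compose)
  qed
  from P.exponential_distributed_sum[OF K(1) ne _ this indep]
  have "distributed ?P lborel (\<lambda>a. \<Sum>p\<in>K. (cmod (a p))\<^sup>2) (erlang_density k 1)"
    using K by simp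
  from distributed_emeasure[OF this, of "{..<x}"] show ?thesis
    using x by (simp add: Gamma_inc_eq_erlang vimage_def Int_def conj_commute)
qed

section \<open>The outage bound\<close>

lemma nn_integral_indicator_eq_emeasure:
  assumes "X \<in> borel_measurable M" "A \<in> sets borel"
  shows "(\<integral>\<^sup>+x. indicator A (X x) \<partial>M) = emeasure M {x \<in> space M. X x \<in> A}"
proof -
  have "(\<integral>\<^sup>+x. indicator A (X x) \<partial>M) = (\<integral>\<^sup>+x. indicator {x \<in> space M. X x \<in> A} x \<partial>M)"
    by (intro nn_integral_cong) (auto split: split_indicator)
  then show ?thesis using assms by simp
qed

lemma measurable_gram_det:
  assumes "{..<r} \<times> {..<c} \<subseteq> I"
  shows "gram_det \<rho> r c \<in> borel_measurable (PiM I (\<lambda>_. CN01))"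
proof -
  have [measurable]: "(\<lambda>H. H (i,j)) \<in> borel_measurable (PiM I (\<lambda>_. CN01))" if "i < r" "j < c" for i j
  proof -
    have "(i,j) \<in> I" using assms that by auto
    from measurable_component_singleton[OF this, of "\<lambda>_. CN01"] show ?thesis
      by (simp cong: measurable_cong_sets)
  qed
  have ent: "(\<lambda>H. gram \<rho> r c H $$ (i, j)) \<in> borel_measurable (PiM I (\<lambda>_. CN01))" if "i < r" "j < r" for i j
  proof -
    have "(\<lambda>H. H (i,k) * cnj (H (j,k))) \<in> borel_measurable (PiM I (\<lambda>_. CN01))" if "k < c" for k
      using that \<open>i < r\<close> \<open>j < r\<close>
      by (intro borel_measurable_times borel_measurable_continuous_on[of cnj] continuous_intros) measurable
    then show ?thesis using that
      by (auto simp: gram_def intro!: borel_measurable_add borel_measurable_times borel_measurable_sum)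
  qed
  have "(\<lambda>H. \<Sum>p \<in> {p. p permutes {0..<r}}. signof p * (\<Prod>i = 0..<r. gram \<rho> r c H $$ (i, p i)))
      \<in> borel_measurable (PiM I (\<lambda>_. CN01))"
    by (intro borel_measurable_sum borel_measurable_times borel_measurable_const borel_measurable_prod ent)
       (auto dest: permutes_in_image)
  then have "(\<lambda>H. det (gram \<rho> r c H)) \<in> borel_measurable (PiM I (\<lambda>_. CN01))"
    by (simp add: det_def'[OF gram_carrier])
  then show ?thesis unfolding gram_det_def by measurable
qed

text \<open>Column \<open>c\<close> is fixed at \<open>u\<close> while the earlier columns stay
  variable, so that integrals over the latter can be compared for different
  \<open>u\<close>.\<close>

definition with_column :: "nat \<Rightarrow> (nat \<Rightarrow> complex) \<Rightarrow> (nat \<times> nat \<Rightarrow> complex) \<Rightarrow> nat \<times> nat \<Rightarrow> complex" where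
  "with_column c u y = (\<lambda>(i,j). if j = c then u i else y (i,j))"

lemma measurable_gram_det_with_column:
  "(\<lambda>y. gram_det \<rho> r (Suc c) (with_column c u y)) \<in> borel_measurable (PiM ({..<r} \<times> {..<c}) (\<lambda>_. CN01))"
proof -
  let ?M = "PiM ({..<r} \<times> {..<c}) (\<lambda>_. CN01)" and ?I = "{..<r} \<times> {..<Suc c}"
  \<comment> \<open>Points of a product space are \<open>undefined\<close> outside the index set,
    hence the restriction; the determinant does not notice it.\<close>
  have "(\<lambda>y. restrict (with_column c u y) ?I) \<in> ?M \<rightarrow>\<^sub>M PiM ?I (\<lambda>_. CN01)"
  proof (rule measurable_restrict)
    fix p assume p: "p \<in> ?I"
    show "(\<lambda>y. with_column c u y p) \<in> ?M \<rightarrow>\<^sub>M CN01"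
    proof (cases "snd p = c")
      case True
      then show ?thesis by (simp add: with_column_def case_prod_unfold)
    next
      case False
      then have "p \<in> {..<r} \<times> {..<c}" using p by auto
      from measurable_component_singleton[OF this, of "\<lambda>_. CN01"] False show ?thesis
        by (simp add: with_column_def case_prod_unfold)
    qed
  qed
  from measurable_compose[OF this measurable_gram_det[OF subset_refl]]
  have "(\<lambda>y. gram_det \<rho> r (Suc c) (restrict (with_column c u y) ?I)) \<in> borel_measurable ?M" .
  moreover have "gram_det \<rho> r (Suc c) (restrict H ?I) = gram_det \<rho> r (Suc c) H" for H
    by (rule gram_det_cong) auto
  ultimately show ?thesis by simp
qed

text \<open>The entries of the column are rotated into its last entry, one after the other. Each
  rotation acts on the other columns as well, which preserves both the determinant and their law.
  For \<open>k = r\<close> only the last entry survives, and it carries the whole norm.\<close>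

lemma nn_integral_rotate_column:
  assumes "k \<le> r"
  shows "\<exists>u'. (\<forall>i<k. u' i = 0) \<and> (\<Sum>i<Suc r. (cmod (u' i))\<^sup>2) = (\<Sum>i<Suc r. (cmod (u i))\<^sup>2) \<and>
    (\<forall>g :: real \<Rightarrow> ennreal. g \<in> borel_measurable borel \<longrightarrow>
      (\<integral>\<^sup>+y. g (gram_det \<rho> (Suc r) (Suc c) (with_column c u' y)) \<partial>PiM ({..<Suc r} \<times> {..<c}) (\<lambda>_. CN01)) =
      (\<integral>\<^sup>+y. g (gram_det \<rho> (Suc r) (Suc c) (with_column c u y)) \<partial>PiM ({..<Suc r} \<times> {..<c}) (\<lambda>_. CN01)))"
  using assms
proof (induction k)
  case 0
  show ?case by (intro exI[of _ u]) auto
next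
  case (Suc k)
  let ?M = "PiM ({..<Suc r} \<times> {..<c}) (\<lambda>_. CN01)"
  let ?D = "gram_det \<rho> (Suc r) (Suc c)"
  from Suc obtain u' where u': "\<forall>i<k. u' i = 0" "(\<Sum>i<Suc r. (cmod (u' i))\<^sup>2) = (\<Sum>i<Suc r. (cmod (u i))\<^sup>2)"
    "\<And>g :: real \<Rightarrow> ennreal. g \<in> borel_measurable borel \<Longrightarrow>
      (\<integral>\<^sup>+y. g (?D (with_column c u' y)) \<partial>?M) = (\<integral>\<^sup>+y. g (?D (with_column c u y)) \<partial>?M)"
    by auto
  show ?case
  proof (cases "u' k = 0")
    case True
    then show ?thesis using u' by (intro exI[of _ u']) (auto simp: less_Suc_eq)
  next
    case False
    define n where "n = sqrt ((cmod (u' k))\<^sup>2 + (cmod (u' r))\<^sup>2)"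
    have n: "n > 0" using False by (simp add: n_def add_pos_nonneg)
    \<comment> \<open>Chosen so that \<open>\<alpha> * u' k + \<beta> * u' r = 0\<close>; the
      division by \<open>n\<close> normalizes.\<close>
    define \<alpha> where "\<alpha> = u' r / of_real n"
    define \<beta> where "\<beta> = - u' k / of_real n"
    have "(cmod \<alpha>)\<^sup>2 + (cmod \<beta>)\<^sup>2 = ((cmod (u' k))\<^sup>2 + (cmod (u' r))\<^sup>2) / n\<^sup>2"
      using n by (simp add: \<alpha>_def \<beta>_def norm_divide power_divide add_divide_distrib)
    also have "(cmod (u' k))\<^sup>2 + (cmod (u' r))\<^sup>2 = n\<^sup>2" by (simp add: n_def)
    also have "n\<^sup>2 / n\<^sup>2 = 1" using n by simp
    finally have ab: "(cmod \<alpha>)\<^sup>2 + (cmod \<beta>)\<^sup>2 = 1" .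
    have b0: "\<beta> \<noteq> 0" using False n by (simp add: \<beta>_def)
    define u'' where "u'' = (\<lambda>i. if i = k then \<alpha> * u' k + \<beta> * u' r
      else if i = r then - cnj \<beta> * u' k + cnj \<alpha> * u' r else u' i)"
    have kr: "k < Suc r" "r < Suc r" "k \<noteq> r" using Suc by auto
    have "u'' i = 0" if "i < Suc k" for i
      using that u'(1) kr by (auto simp: u''_def less_Suc_eq \<alpha>_def \<beta>_def)
    moreover have "(\<Sum>i<Suc r. (cmod (u'' i))\<^sup>2) = (\<Sum>i<Suc r. (cmod (u' i))\<^sup>2)"
    proof -
      have split: "(\<Sum>i<Suc r. f i) = f r + f k + (\<Sum>i\<in>{..<r} - {k}. f i)" for f :: "nat \<Rightarrow> real"
        using kr by (simp add: sum.remove[of "{..<r}" k])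
      have "(\<Sum>i\<in>{..<r} - {k}. (cmod (u'' i))\<^sup>2) = (\<Sum>i\<in>{..<r} - {k}. (cmod (u' i))\<^sup>2)"
        by (intro sum.cong) (auto simp: u''_def)
      then show ?thesis
        using norm_square_rotation[OF ab, of "u' k" "u' r"] kr
        unfolding split by (simp add: u''_def)
    qed
    moreover have "(\<integral>\<^sup>+y. g (?D (with_column c u'' y)) \<partial>?M) = (\<integral>\<^sup>+y. g (?D (with_column c u' y)) \<partial>?M)"
      if g: "g \<in> borel_measurable borel" for g :: "real \<Rightarrow> ennreal"
    proof -
      \<comment> \<open>The new column is the old one rotated, so rotating the other columns too
        amounts to rotating the full matrix.\<close>
      have "?D (with_column c u'' (rot_rows \<alpha> \<beta> k r {..<c} y)) = ?D (with_column c u' y)" for y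
      proof -
        have "?D (with_column c u'' (rot_rows \<alpha> \<beta> k r {..<c} y)) =
            ?D (rot_rows \<alpha> \<beta> k r {..<Suc c} (with_column c u' y))"
          by (rule gram_det_cong) (auto simp: with_column_def rot_rows_def u''_def)
        also have "\<dots> = ?D (with_column c u' y)"
          using kr ab by (intro gram_det_rot_rows) auto
        finally show ?thesis .
      qed
      then have "(\<integral>\<^sup>+y. g (?D (with_column c u' y)) \<partial>?M) =
          (\<integral>\<^sup>+y. g (?D (with_column c u'' (rot_rows \<alpha> \<beta> k r {..<c} y))) \<partial>?M)" by simp
      also have "\<dots> = (\<integral>\<^sup>+y. g (?D (with_column c u'' y)) \<partial>?M)"
        using kr ab b0 measurable_compose[OF measurable_gram_det_with_column g]
        by (intro nn_integral_rot_rows[of k "Suc r" r "{..<c}" c "\<lambda>y. g (?D (with_column c u'' y))"]) auto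
      finally show ?thesis by simp
    qed
    ultimately show ?thesis using u' by (intro exI[of _ u'']) auto
  qed
qed

text \<open>One round of the domination. The entries in the last row and column are independent of
  the remaining \<open>r\<close> by \<open>c\<close> block. The comparison is made with the last
  column fixed and the other columns integrated out, because the rotation changes these columns but
  not their law.\<close>

lemma emeasure_gram_det_step:
  assumes rho: "0 < \<rho>" and x: "0 \<le> x"
  shows "ennreal (Gamma_inc x (Suc (r + c))) *
      emeasure (gauss_matrix_measure r c) {H \<in> space (gauss_matrix_measure r c). gram_det \<rho> r c H \<le> t}
    \<le> emeasure (gauss_matrix_measure (Suc r) (Suc c))
        {H \<in> space (gauss_matrix_measure (Suc r) (Suc c)). gram_det \<rho> (Suc r) (Suc c) H < (1 + \<rho> * x) * t}"
proof -
  let ?P = "\<lambda>I :: (nat \<times> nat) set. PiM I (\<lambda>_. CN01)"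
  let ?D = "gram_det \<rho> (Suc r) (Suc c)"
  define I where "I = {..<Suc r} \<times> {..<Suc c}"
  define C where "C = {..<Suc r} \<times> {c}"
  define J where "J = {..<Suc r} \<times> {..<c}"
  define L where "L = {..<r} \<times> {..<c}"
  \<comment> \<open>The corner \<open>(r,c)\<close> already belongs to \<open>C\<close>, so
    \<open>K\<close> has \<open>Suc r + c\<close> elements; this number becomes the shape.\<close>
  define K where "K = C \<union> {r} \<times> {..<c}"
  have fin: "finite I" "finite C" "finite J" "finite L" "finite K"
    by (auto simp: I_def C_def J_def L_def K_def)
  have CJ: "I = C \<union> J" "C \<inter> J = {}" and KL: "I = K \<union> L" "K \<inter> L = {}"
    by (auto simp: I_def C_def J_def K_def L_def)
  have card: "card K = Suc (r + c)"
    unfolding K_def C_def by (subst card_Un_disjoint) (auto simp: card_cartesian_product)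
  have sumK: "(\<Sum>p\<in>K. (cmod (H p))\<^sup>2) = (\<Sum>i<Suc r. (cmod (H (i,c)))\<^sup>2) + (\<Sum>j<c. (cmod (H (r,j)))\<^sup>2)" for H
  proof -
    have "{..<Suc r} \<times> {c} = (\<lambda>i. (i,c)) ` {..<Suc r}" "{r} \<times> {..<c} = (\<lambda>j. (r,j)) ` {..<c}" by auto
    then show ?thesis unfolding K_def C_def
      by (subst sum.union_disjoint) (auto simp: sum.reindex inj_on_def simp del: sum.lessThan_Suc)
  qed
  have comp: "(\<lambda>H. H p) \<in> borel_measurable (?P A)" if "p \<in> A" for p A
    using measurable_component_singleton[OF that, of "\<lambda>_. CN01"] by (simp cong: measurable_cong_sets)
  have sum_meas [measurable]: "(\<lambda>H. \<Sum>p\<in>K. (cmod (H p))\<^sup>2) \<in> borel_measurable (?P A)" if "K \<subseteq> A" for A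
    using that by (auto intro!: borel_measurable_sum borel_measurable_power borel_measurable_norm comp)
  define f where "f H = (indicator {..<(1 + \<rho> * x) * t} (?D H) :: ennreal)" for H
  define h where "h H = (indicator {..<x} (\<Sum>p\<in>K. (cmod (H p))\<^sup>2) * indicator {..t} (gram_det \<rho> r c H) :: ennreal)" for H
  have LI: "{..<r} \<times> {..<c} \<subseteq> I" "{..<r} \<times> {..<c} \<subseteq> L" "{..<Suc r} \<times> {..<Suc c} \<subseteq> I" "K \<subseteq> I" "K \<subseteq> K"
    using KL by (auto simp: L_def I_def)
  note [measurable] = measurable_gram_det[OF LI(1)] measurable_gram_det[OF LI(2)] measurable_gram_det[OF LI(3)]
    sum_meas[OF LI(4)] sum_meas[OF LI(5)]
  have f: "f \<in> borel_measurable (?P I)" unfolding f_def by measurable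
  have h: "h \<in> borel_measurable (?P I)" unfolding h_def by measurable
  \<comment> \<open>First split: the two conditions in \<open>h\<close> concern the disjoint
    coordinate sets \<open>K\<close> and \<open>L\<close>, so the integral is a product.\<close>
  have "(\<integral>\<^sup>+H. h H \<partial>?P I) = (\<integral>\<^sup>+a. \<integral>\<^sup>+b. h (merge K L (a, b)) \<partial>?P L \<partial>?P K)"
    using KL fin h by (simp add: CN01_PiM.product_nn_integral_fold)
  also have "\<dots> = (\<integral>\<^sup>+a. \<integral>\<^sup>+b. indicator {..<x} (\<Sum>p\<in>K. (cmod (a p))\<^sup>2) * indicator {..t} (gram_det \<rho> r c b) \<partial>?P L \<partial>?P K)"
  proof (intro nn_integral_cong)
    fix a b
    have "(\<Sum>p\<in>K. (cmod (merge K L (a, b) p))\<^sup>2) = (\<Sum>p\<in>K. (cmod (a p))\<^sup>2)"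
      by (intro sum.cong) (auto simp: merge_def)
    moreover have "gram_det \<rho> r c (merge K L (a, b)) = gram_det \<rho> r c b"
      by (rule gram_det_cong) (auto simp: merge_def K_def L_def C_def)
    ultimately show "h (merge K L (a, b)) = indicator {..<x} (\<Sum>p\<in>K. (cmod (a p))\<^sup>2) * indicator {..t} (gram_det \<rho> r c b)"
      by (simp add: h_def)
  qed
  also have "\<dots> = (\<integral>\<^sup>+a. indicator {..<x} (\<Sum>p\<in>K. (cmod (a p))\<^sup>2) \<partial>?P K) * (\<integral>\<^sup>+b. indicator {..t} (gram_det \<rho> r c b) \<partial>?P L)"
    by (subst nn_integral_cmult, measurable, subst nn_integral_multc) simp_all
  also have "(\<integral>\<^sup>+a. indicator {..<x} (\<Sum>p\<in>K. (cmod (a p))\<^sup>2) \<partial>?P K) = ennreal (Gamma_inc x (Suc (r + c)))"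
    using emeasure_PiM_CN01_norm_square_less[OF fin(5) card x]
    by (subst nn_integral_indicator_eq_emeasure) simp_all
  also have "(\<integral>\<^sup>+b. indicator {..t} (gram_det \<rho> r c b) \<partial>?P L) = emeasure (?P L) {b \<in> space (?P L). gram_det \<rho> r c b \<le> t}"
    by (subst nn_integral_indicator_eq_emeasure) simp_all
  finally have lhs: "ennreal (Gamma_inc x (Suc (r + c))) * emeasure (?P L) {b \<in> space (?P L). gram_det \<rho> r c b \<le> t}
    = (\<integral>\<^sup>+H. h H \<partial>?P I)" ..
  \<comment> \<open>Second split of the same integral, into the last column and the other columns,
    so that the column can be rotated.\<close>
  also have "\<dots> = (\<integral>\<^sup>+u. \<integral>\<^sup>+y. h (merge C J (u, y)) \<partial>?P J \<partial>?P C)"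
    using CJ fin h by (simp add: CN01_PiM.product_nn_integral_fold)
  also have "\<dots> \<le> (\<integral>\<^sup>+u. \<integral>\<^sup>+y. f (merge C J (u, y)) \<partial>?P J \<partial>?P C)"
  proof (rule nn_integral_mono)
    fix u :: "nat \<times> nat \<Rightarrow> complex"
    define v where "v i = u (i,c)" for i
    obtain v' where v': "\<forall>i<r. v' i = 0" "(\<Sum>i<Suc r. (cmod (v' i))\<^sup>2) = (\<Sum>i<Suc r. (cmod (v i))\<^sup>2)"
      "\<And>g :: real \<Rightarrow> ennreal. g \<in> borel_measurable borel \<Longrightarrow>
        (\<integral>\<^sup>+y. g (?D (with_column c v' y)) \<partial>?P J) = (\<integral>\<^sup>+y. g (?D (with_column c v y)) \<partial>?P J)"
      using nn_integral_rotate_column[where k=r and r=r and u=v and \<rho>=\<rho> and c=c, OF order_refl] unfolding J_def by blast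
    have v'r: "(cmod (v' r))\<^sup>2 = (\<Sum>i<Suc r. (cmod (v i))\<^sup>2)"
      using v'(1) unfolding v'(2)[symmetric] by simp
    have "h (merge C J (u, y)) \<le> indicator {..<(1 + \<rho> * x) * t} (?D (with_column c v' y))" for y
    proof (cases "h (merge C J (u, y)) = 0")
      case False
      let ?H = "merge C J (u, y)"
      have "gram_det \<rho> r c ?H = gram_det \<rho> r c y"
        by (rule gram_det_cong) (auto simp: merge_def J_def C_def)
      moreover have "(\<Sum>p\<in>K. (cmod (?H p))\<^sup>2) = (cmod (v' r))\<^sup>2 + (\<Sum>j<c. (cmod (y (r,j)))\<^sup>2)"
        unfolding sumK v'r
        by (intro arg_cong2[where f="(+)"] sum.cong) (auto simp: merge_def C_def J_def v_def)
      ultimately have S: "(cmod (v' r))\<^sup>2 + (\<Sum>j<c. (cmod (y (r,j)))\<^sup>2) < x" and D: "gram_det \<rho> r c y \<le> t"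
        using False by (auto simp: h_def indicator_def split: if_splits)
      have Dpos: "0 < gram_det \<rho> r c y" using rho gram_det_real_pos[of \<rho> r c y] by simp
      \<comment> \<open>The rotated column vanishes in the first \<open>r\<close> rows, so it enters
        only through row \<open>r\<close>, where Fischer's inequality picks up its full
        norm.\<close>
      have "gram_det \<rho> r (Suc c) (with_column c v' y) = gram_det \<rho> r c (with_column c v' y)"
        using v'(1) by (simp add: gram_det_def gram_Suc_zero_column with_column_def)
      also have "\<dots> = gram_det \<rho> r c y"
        by (rule gram_det_cong) (auto simp: with_column_def)
      finally have "?D (with_column c v' y) \<le> (1 + \<rho> * ((cmod (v' r))\<^sup>2 + (\<Sum>j<c. (cmod (y (r,j)))\<^sup>2))) * gram_det \<rho> r c y"
        using gram_det_Fischer[of \<rho> r "Suc c" "with_column c v' y"] rho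
        by (simp add: with_column_def add.commute)
      \<comment> \<open>The strict bound on the sum of squares makes the conclusion strict although
        the bound on the block is not.\<close>
      also have "\<dots> < (1 + \<rho> * x) * gram_det \<rho> r c y"
        using S Dpos rho by simp
      also have "\<dots> \<le> (1 + \<rho> * x) * t"
        using D rho x by (intro mult_left_mono) auto
      finally have "?D (with_column c v' y) < (1 + \<rho> * x) * t" .
      then show ?thesis by (auto simp: h_def indicator_def)
    qed simp
    then have "(\<integral>\<^sup>+y. h (merge C J (u, y)) \<partial>?P J) \<le> (\<integral>\<^sup>+y. indicator {..<(1 + \<rho> * x) * t} (?D (with_column c v' y)) \<partial>?P J)"
      by (intro nn_integral_mono)
    also have "\<dots> = (\<integral>\<^sup>+y. indicator {..<(1 + \<rho> * x) * t} (?D (with_column c v y)) \<partial>?P J)"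
      by (rule v'(3)) simp
    also have "\<dots> = (\<integral>\<^sup>+y. f (merge C J (u, y)) \<partial>?P J)"
    proof (intro nn_integral_cong)
      fix y
      have "?D (merge C J (u, y)) = ?D (with_column c v y)"
        by (rule gram_det_cong) (auto simp: merge_def J_def C_def with_column_def v_def)
      then show "indicator {..<(1 + \<rho> * x) * t} (?D (with_column c v y)) = f (merge C J (u, y))"
        by (simp add: f_def)
    qed
    finally show "(\<integral>\<^sup>+y. h (merge C J (u, y)) \<partial>?P J) \<le> (\<integral>\<^sup>+y. f (merge C J (u, y)) \<partial>?P J)" .
  qed
  also have "\<dots> = (\<integral>\<^sup>+H. f H \<partial>?P I)"
    using CJ fin f by (simp add: CN01_PiM.product_nn_integral_fold)
  also have "\<dots> = emeasure (?P I) {H \<in> space (?P I). ?D H < (1 + \<rho> * x) * t}"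
    unfolding f_def by (subst nn_integral_indicator_eq_emeasure) simp_all
  finally show ?thesis
    by (simp add: gauss_matrix_measure_def I_def L_def)
qed

section \<open>Induction on the matrix size\<close>

lemma prob_space_gauss_matrix: "prob_space (gauss_matrix_measure r c)"
  unfolding gauss_matrix_measure_def by (intro prob_space_PiM prob_space_CN01)

lemma measurable_gram_det_gauss_matrix [measurable]:
  "gram_det \<rho> r c \<in> borel_measurable (gauss_matrix_measure r c)"
  unfolding gauss_matrix_measure_def by (intro measurable_gram_det) auto

text \<open>The factor \<open>l = 1\<close>, of shape \<open>r + c + 1\<close>, is peeled off.
  Shifting the index turns the other shapes \<open>r + c + 3 - 2 * Suc l\<close> into
  \<open>r + c + 1 - 2 * l\<close>, those of the smaller matrix. A nonstrict bound for the smaller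
  size gives a strict one for the larger.\<close>

lemma prob_gram_det_less_step:
  assumes rho: "0 < \<rho>" and x: "\<forall>l\<in>{1..Suc (min r c)}. 0 \<le> x l"
    and IH: "(\<Prod>l=1..min r c. Gamma_inc (x (Suc l)) (r + c + 1 - 2 * l)) \<le>
      measure (gauss_matrix_measure r c)
        {H \<in> space (gauss_matrix_measure r c). gram_det \<rho> r c H \<le> (\<Prod>l=1..min r c. 1 + \<rho> * x (Suc l))}"
  shows "(\<Prod>l=1..Suc (min r c). Gamma_inc (x l) (Suc r + Suc c + 1 - 2 * l)) \<le>
      measure (gauss_matrix_measure (Suc r) (Suc c))
        {H \<in> space (gauss_matrix_measure (Suc r) (Suc c)).
          gram_det \<rho> (Suc r) (Suc c) H < (\<Prod>l=1..Suc (min r c). 1 + \<rho> * x l)}"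
proof -
  interpret G: prob_space "gauss_matrix_measure r c" by (rule prob_space_gauss_matrix)
  interpret GS: prob_space "gauss_matrix_measure (Suc r) (Suc c)" by (rule prob_space_gauss_matrix)
  have shift: "(\<Prod>l=1..Suc m. F l) = F 1 * (\<Prod>l=1..m. F (Suc l))" for F :: "nat \<Rightarrow> real" and m
    by (induction m) (simp_all add: mult.assoc)
  have x1: "0 \<le> x 1" using x by auto
  have "(\<Prod>l=1..Suc (min r c). Gamma_inc (x l) (Suc r + Suc c + 1 - 2 * l)) =
    Gamma_inc (x 1) (Suc (r + c)) * (\<Prod>l=1..min r c. Gamma_inc (x (Suc l)) (r + c + 1 - 2 * l))"
    unfolding shift by simp
  also have "\<dots> \<le> Gamma_inc (x 1) (Suc (r + c)) * measure (gauss_matrix_measure r c)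
        {H \<in> space (gauss_matrix_measure r c). gram_det \<rho> r c H \<le> (\<Prod>l=1..min r c. 1 + \<rho> * x (Suc l))}"
    using IH Gamma_inc_eq_erlang(2)[OF x1] by (intro mult_left_mono)
  also have "\<dots> \<le> measure (gauss_matrix_measure (Suc r) (Suc c))
        {H \<in> space (gauss_matrix_measure (Suc r) (Suc c)).
          gram_det \<rho> (Suc r) (Suc c) H < (1 + \<rho> * x 1) * (\<Prod>l=1..min r c. 1 + \<rho> * x (Suc l))}"
    using emeasure_gram_det_step[OF rho x1, of r c "\<Prod>l=1..min r c. 1 + \<rho> * x (Suc l)"]
      Gamma_inc_eq_erlang(2)[OF x1, of "r + c"]
    unfolding G.emeasure_eq_measure GS.emeasure_eq_measure
    by (simp add: ennreal_mult[symmetric])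
  also have "(1 + \<rho> * x 1) * (\<Prod>l=1..min r c. 1 + \<rho> * x (Suc l)) = (\<Prod>l=1..Suc (min r c). 1 + \<rho> * x l)"
    unfolding shift ..
  finally show ?thesis .
qed

text \<open>The nonstrict form is the one that can start the induction: with no rows or no columns
  the determinant and the empty product both equal 1.\<close>

lemma prob_gram_det_le:
  assumes rho: "0 < \<rho>" and x: "\<forall>l\<in>{1..min r c}. 0 \<le> x l"
  shows "(\<Prod>l=1..min r c. Gamma_inc (x l) (r + c + 1 - 2 * l)) \<le>
      measure (gauss_matrix_measure r c)
        {H \<in> space (gauss_matrix_measure r c). gram_det \<rho> r c H \<le> (\<Prod>l=1..min r c. 1 + \<rho> * x l)}"
  using x
proof (induction r arbitrary: c x)
  case 0
  interpret prob_space "gauss_matrix_measure 0 c" by (rule prob_space_gauss_matrix)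
  show ?case by (simp add: gram_det_def prob_space)
next
  case (Suc r)
  show ?case
  proof (cases c)
    case 0
    interpret prob_space "gauss_matrix_measure (Suc r) 0" by (rule prob_space_gauss_matrix)
    have "gram \<rho> (Suc r) 0 H = 1\<^sub>m (Suc r)" for H
      by (rule eq_matI) (auto simp: gram_def)
    with 0 show ?thesis by (simp add: gram_det_def prob_space)
  next
    case c: (Suc c')
    interpret prob_space "gauss_matrix_measure (Suc r) (Suc c')" by (rule prob_space_gauss_matrix)
    have "(\<Prod>l=1..Suc (min r c'). Gamma_inc (x l) (Suc r + Suc c' + 1 - 2 * l)) \<le>
      prob {H \<in> space (gauss_matrix_measure (Suc r) (Suc c')).
          gram_det \<rho> (Suc r) (Suc c') H < (\<Prod>l=1..Suc (min r c'). 1 + \<rho> * x l)}"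
      using Suc.prems unfolding c
      by (intro prob_gram_det_less_step rho Suc.IH) auto
    also have "\<dots> \<le> prob {H \<in> space (gauss_matrix_measure (Suc r) (Suc c')).
          gram_det \<rho> (Suc r) (Suc c') H \<le> (\<Prod>l=1..Suc (min r c'). 1 + \<rho> * x l)}"
      by (intro finite_measure_mono) auto
    finally show ?thesis unfolding c by simp
  qed
qed

text \<open>Outage asks for a strict inequality, which the last round of the induction supplies for
  positive sizes.\<close>

lemma prob_gram_det_less:
  assumes rho: "0 < \<rho>" and pos: "0 < r" "0 < c" and x: "\<forall>l\<in>{1..min r c}. 0 \<le> x l"
  shows "(\<Prod>l=1..min r c. Gamma_inc (x l) (r + c + 1 - 2 * l)) \<le>
      measure (gauss_matrix_measure r c)
        {H \<in> space (gauss_matrix_measure r c). gram_det \<rho> r c H < (\<Prod>l=1..min r c. 1 + \<rho> * x l)}"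
proof -
  obtain r' c' where rc: "r = Suc r'" "c = Suc c'" using pos by (metis gr0_implies_Suc)
  have "(\<Prod>l=1..Suc (min r' c'). Gamma_inc (x l) (Suc r' + Suc c' + 1 - 2 * l)) \<le>
      measure (gauss_matrix_measure (Suc r') (Suc c'))
        {H \<in> space (gauss_matrix_measure (Suc r') (Suc c')).
          gram_det \<rho> (Suc r') (Suc c') H < (\<Prod>l=1..Suc (min r' c'). 1 + \<rho> * x l)}"
    using x rc by (intro prob_gram_det_less_step rho prob_gram_det_le) auto
  then show ?thesis unfolding rc by simp
qed

theorem theorem2:
  fixes Nt Nm Ne :: nat and \<eta> g rs :: real and a :: "nat \<Rightarrow> real"
  assumes "0 < Nt" "0 < Nm" "0 < Ne" "Ne < Nt"
    and "0 < \<eta>" "0 < g" "0 < rs"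
    and "\<forall>l\<in>{1..min (Nt - Ne) Nm}. 0 < a l"
    and "\<forall>l\<in>{1..<min (Nt - Ne) Nm}. a (Suc l) \<le> a l"
    and "(\<Sum>l=1..min (Nt - Ne) Nm. a l) = rs"
  shows "(\<Prod>l=1..min (Nt - Ne) Nm.
            Gamma_inc (xi_fun (Nt - Ne) \<eta> g (a l))
              (max (Nt - Ne) Nm + min (Nt - Ne) Nm + 1 - 2 * l))
         \<le> P_out_ZF Nm (Nt - Ne) \<eta> g rs"
proof -
  define n where "n = Nt - Ne"
  define \<rho> where "\<rho> = \<eta> / real n"
  have n: "0 < n" using assms by (simp add: n_def)
  have rho: "0 < \<rho>" using n assms by (simp add: \<rho>_def)
  have base: "1 < 1 + g * \<eta>" using assms by simp
  \<comment> \<open>The factors \<open>\<eta> / n\<close> and \<open>n / \<eta>\<close> cancel, so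
    each threshold contributes a pure power and the exponents \<open>a l\<close> add up to
    \<open>rs\<close>.\<close>
  have xi: "1 + \<rho> * xi_fun n \<eta> g s = (1 + g * \<eta>) powr s" for s
    using n assms by (simp add: \<rho>_def xi_fun_def)
  have xi0: "\<forall>l\<in>{1..min Nm n}. 0 \<le> xi_fun n \<eta> g (a l)"
    using assms base by (auto simp: xi_fun_def n_def min.commute ge_one_powr_ge_zero less_imp_le)
  have "(\<Prod>l=1..min Nm n. 1 + \<rho> * xi_fun n \<eta> g (a l)) = (1 + g * \<eta>) powr (\<Sum>l=1..min Nm n. a l)"
    unfolding xi using base by (simp add: powr_sum)
  also have "(\<Sum>l=1..min Nm n. a l) = rs"
    using assms by (simp add: n_def min.commute)
  finally have prod: "(\<Prod>l=1..min Nm n. 1 + \<rho> * xi_fun n \<eta> g (a l)) = (1 + g * \<eta>) powr rs" .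
  \<comment> \<open>Positivity of the determinant allows the logarithm to be removed.\<close>
  have less_iff: "ln (gram_det \<rho> Nm n H) < rs * ln (1 + g * \<eta>) \<longleftrightarrow> gram_det \<rho> Nm n H < (1 + g * \<eta>) powr rs" for H
  proof -
    have "rs * ln (1 + g * \<eta>) = ln ((1 + g * \<eta>) powr rs)" using base by (simp add: ln_powr)
    then show ?thesis
      using gram_det_real_pos[of \<rho> Nm n H] rho base by (simp only: ln_less_cancel_iff powr_gt_zero)
  qed
  have "P_out_ZF Nm n \<eta> g rs = measure (gauss_matrix_measure Nm n)
      {H \<in> space (gauss_matrix_measure Nm n). gram_det \<rho> Nm n H < (1 + g * \<eta>) powr rs}"
    unfolding P_out_ZF_def \<rho>_def[symmetric] gram_eq_to_mat gram_det_def[symmetric] less_iff ..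
  \<comment> \<open>Identifies the shapes: \<open>k + m\<close> in the claim is the sum
    \<open>r + c\<close> of the matrix dimensions in the bound.\<close>
  moreover have "max n Nm + min n Nm = Nm + n" by simp
  ultimately show ?thesis
    using prob_gram_det_less[OF rho assms(2) n xi0] unfolding prod n_def[symmetric]
    by (simp add: min.commute)
qed

end
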